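(* Let $f,g:[a,b]\to\mathbb{R}$ be integrable functions such that $0\le g(t)\le 1$ for all $t\in[a,b]$ and such that $\int_a^b g(t)\,df(t)$ exists. Put $\lambda:=\int_a^b g(t)\,dt$. Suppose $f$ is absolutely continuous on $[a,b]$ with $f'\in L_p[a,b]$, $1\le p\le\infty$. Then $$\left|\int_a^{a+\lambda} f(t)\,dt-\int_a^b f(t)g(t)\,dt\right|\le\begin{cases}\frac12\left[\lambda^2+(b-a-\lambda)^2\right]\|f'\|_{\infty,[a,b]}, & \text{if } f'\in L_\infty[a,b];\\[2mm] \dfrac{\|f'\|_{p,[a,b]}}{(q+1)^{1/q}}\left[\lambda^{(q+1)/q}+(b-a-\lambda)^{(q+1)/q}\right], & \text{if } f'\in L_p[a,b],\ 1<p<\infty,\ \frac1p+\frac1q=1;\\[2mm] \left[\int_{a+\lambda}^b g(t)\,dt\right]\|f'\|_{1,[a,b]}, & \text{if } f'\in L_1[a,b],\end{cases}$$ and $$\left|\int_a^b f(t)g(t)\,dt-\int_{b-\lambda}^b f(t)\,dt\right|\le\begin{cases}\frac12\left[\lambda^2+(b-a-\lambda)^2\right]\|f'\|_{\infty,[a,b]}, & \text{if } f'\in L_\infty[a,b];\\[2mm] \dfrac{\|f'\|_{p,[a,b]}}{(q+1)^{1/q}}\left[\lambda^{(q+1)/q}+(b-a-\lambda)^{(q+1)/q}\right], & \text{if } f'\in L_p[a,b],\ 1<p<\infty,\ \frac1p+\frac1q=1;\\[2mm] \left[\int_a^{b-\lambda} g(t)\,dt\right]\|f'\|_{1,[a,b]},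 & \text{if } f'\in L_1[a,b].\end{cases}$$ In each of the two displays, each bound holds whenever its stated integrability condition on $f'$ holds.
   Context: Here $a<b$ are real numbers and $\int_a^b g(t)\,df(t)$ denotes the Riemann–Stieltjes integral of $g$ with respect to $f$. For $1\le p<\infty$, $\|h\|_{p,[a,b]}=\left(\int_a^b|h(x)|^p\,dx\right)^{1/p}$, and $\|h\|_{\infty,[a,b]}$ is the essential supremum of $|h|$ on $[a,b]$. *)

theory Defs
  imports "HOL-Analysis.Analysis" "HOL-Probability.Essential_Supremum"
begin

text \<open>
  Absolute continuity on \<open>[a,b]\<close>. A \<open>division_of\<close> is a finite family of nonempty
  compact intervals with pairwise disjoint interiors, so \<open>K = [Inf K, Sup K]\<close>;
  the family need not cover \<open>[a,b]\<close>.
\<close>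

definition absolutely_continuous_on_interval :: "real \<Rightarrow> real \<Rightarrow> (real \<Rightarrow> real) \<Rightarrow> bool" where
  "absolutely_continuous_on_interval a b f \<longleftrightarrow>
     (\<forall>\<epsilon>>0. \<exists>\<delta>>0. \<forall>D T. D division_of T \<and> T \<subseteq> {a..b} \<and> (\<Sum>K\<in>D. Sup K - Inf K) < \<delta> \<longrightarrow>
        (\<Sum>K\<in>D. \<bar>f (Sup K) - f (Inf K)\<bar>) < \<epsilon>)"

text \<open>
  The Riemann--Stieltjes integral of \<open>g\<close> with respect to \<open>f\<close>, as a limit of
  Riemann--Stieltjes sums for mesh tending to zero. Degenerate intervals, which
  \<open>tagged_division_of\<close> permits, contribute nothing to the sums.
\<close>

definition has_RS_integral ::
    "(real \<Rightarrow> real) \<Rightarrow> (real \<Rightarrow> real) \<Rightarrow> real \<Rightarrow> real \<Rightarrow> real \<Rightarrow> bool" where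
  "has_RS_integral g f a b I \<longleftrightarrow>
     (\<forall>\<epsilon>>0. \<exists>\<delta>>0. \<forall>\<D>. \<D> tagged_division_of {a..b} \<and> (\<forall>(x, K)\<in>\<D>. Sup K - Inf K < \<delta>) \<longrightarrow>
        \<bar>(\<Sum>(x, K)\<in>\<D>. g x * (f (Sup K) - f (Inf K))) - I\<bar> < \<epsilon>)"

definition RS_integrable :: "(real \<Rightarrow> real) \<Rightarrow> (real \<Rightarrow> real) \<Rightarrow> real \<Rightarrow> real \<Rightarrow> bool" where
  "RS_integrable g f a b \<longleftrightarrow> (\<exists>I. has_RS_integral g f a b I)"

text \<open>
  Membership in \<open>L\<^sub>p(S)\<close> and the \<open>L\<^sub>p\<close> norm with respect to Lebesgue measure,
  for exponents \<open>1 \<le> p \<le> \<infinity>\<close>.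
\<close>

definition in_Lp :: "ereal \<Rightarrow> real set \<Rightarrow> (real \<Rightarrow> real) \<Rightarrow> bool" where
  "in_Lp p S h \<longleftrightarrow> h \<in> borel_measurable (lebesgue_on S) \<and>
     (if p = \<infinity> then esssup (lebesgue_on S) (\<lambda>x. ereal \<bar>h x\<bar>) < \<infinity>
      else set_integrable lebesgue S (\<lambda>x. \<bar>h x\<bar> powr real_of_ereal p))"

definition Lp_norm :: "ereal \<Rightarrow> real set \<Rightarrow> (real \<Rightarrow> real) \<Rightarrow> real" where
  "Lp_norm p S h =
     (if p = \<infinity> then real_of_ereal (esssup (lebesgue_on S) (\<lambda>x. ereal \<bar>h x\<bar>))
      else (LINT x:S|lebesgue. \<bar>h x\<bar> powr real_of_ereal p) powr (1 / real_of_ereal p))"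

end

theory Submission
  imports Defs
begin

text \<open>
  With \<open>c = a + \<lambda>\<close>, the function \<open>s = 1\<^bsub>[a,c]\<^esub> - g\<close> has integral zero over \<open>[a,b]\<close>, so the first difference
  equals the integral of \<open>(f t - f c) * s t\<close>. Absolute continuity bounds \<open>\<bar>f t - f c\<bar>\<close> by the integral of
  \<open>\<bar>f'\<bar>\<close> between \<open>t\<close> and \<open>c\<close>; exchanging the integrals leaves \<open>\<integral> \<bar>f' x\<bar> * W x dx\<close>, where \<open>W x\<close> is the integral of
  \<open>1 - g\<close> over \<open>[a,x]\<close> for \<open>x < c\<close> and of \<open>g\<close> over \<open>[x,b]\<close> for \<open>x > c\<close>. As \<open>0 \<le> g \<le> 1\<close>, \<open>W\<close> is at most
  \<open>x - a\<close>, respectively \<open>b - x\<close>, and also at most \<open>\<integral>\<^bsub>[c,b]\<^esub> g\<close>; Hoelder's inequality gives the three bounds.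
  The second display is the first one for \<open>1 - g\<close>.

  For an absolutely continuous \<open>f\<close> the derivative exists almost everywhere by two applications of Vitali's
  covering theorem, without passing through functions of bounded variation; a gauge argument then
  recovers the increments of \<open>f\<close> as Henstock--Kurzweil integrals of its derivative.
\<close>

subsection \<open>Vitali coverings and divisions\<close>

text \<open>Vitali's theorem gives countably many disjoint intervals inside \<open>U\<close> that
  cover \<open>S\<close> up to a null set. Their union has finite measure, so finitely many of them
  already carry all of it but less than \<open>e\<close>. Since \<open>S\<close> need not be
  measurable, what is missed is enclosed in a measurable \<open>W\<close>.\<close>

lemma Vitali_intervals_finite:
  fixes S U :: "real set"
  assumes "open U" "U \<in> lmeasurable" "S \<subseteq> U" "e > 0"
    and cov: "\<And>x d. x \<in> S \<Longrightarrow> 0 < d \<Longrightarrow> \<exists>u v. u < v \<and> x \<in> {u..v} \<and> v - u < d \<and> P u v"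
  obtains D W where "D division_of \<Union>D" "\<Union>D \<subseteq> U"
    "\<And>K. K \<in> D \<Longrightarrow> \<exists>u v. u < v \<and> K = {u..v} \<and> P u v"
    "W \<in> lmeasurable" "measure lebesgue W < e" "S \<subseteq> \<Union>D \<union> W"
proof -
  define K where "K = {(u,v). u < v \<and> P u v \<and> {u..v} \<subseteq> U}"
  \<comment> \<open>Midpoint and half-length, so that the intervals become the closed balls of the
    covering theorem.\<close>
  define c where "c = (\<lambda>(u::real,v). (u+v)/2)"
  define r where "r = (\<lambda>(u::real,v). (v-u)/2)"
  have cb: "cball (c i) (r i) = {fst i..snd i}" for i
    by (auto simp: c_def r_def cball_eq_atLeastAtMost field_simps split: prod.split)
  have pos: "0 < r i" if "i \<in> K" for i
    using that by (auto simp: K_def r_def)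
  have ex: "\<exists>i. i \<in> K \<and> x \<in> cball (c i) (r i) \<and> r i < d" if x: "x \<in> S" and d: "0 < d" for x d
  proof -
    from assms(1,3) x obtain e where e: "e > 0" "ball x e \<subseteq> U"
      by (meson openE subsetD)
    obtain u v where uv: "u < v" "x \<in> {u..v}" "v - u < min d e" "P u v"
      using cov[of x "min d e"] x d e by fastforce
    have "{u..v} \<subseteq> ball x e" using uv by (auto simp: dist_real_def)
    with e uv have "(u,v) \<in> K" by (auto simp: K_def)
    moreover have "r (u,v) < d" using uv by (auto simp: r_def)
    ultimately show ?thesis using uv(2) unfolding cb by force
  qed
  obtain C where C: "countable C" "C \<subseteq> K"
     "pairwise (\<lambda>i j. disjnt (cball (c i) (r i)) (cball (c j) (r j))) C"
     and neg: "negligible(S - (\<Union>i \<in> C. cball (c i) (r i)))"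
    by (rule Vitali_covering_theorem_cballs[OF pos ex]) blast+
  define E where "E = (\<lambda>i. {fst i..snd i}) ` C"
  have CU: "\<Union>E \<subseteq> U" using C(2) by (force simp: E_def K_def)
  have cE: "countable E" using C(1) by (simp add: E_def)
  have mE: "X \<in> lmeasurable" if "X \<in> E" for X using that by (auto simp: E_def)
  have sE: "\<Union>E \<in> sets lebesgue"
    using cE mE by (intro sets.countable_Union) (auto simp: fmeasurableD)
  have mUE: "\<Union>E \<in> lmeasurable" by (rule fmeasurableI2[OF assms(2) CU sE])
  obtain D where D: "D \<subseteq> E" "finite D" "measure lebesgue (\<Union>E) - e < measure lebesgue (\<Union>D)"
  proof (rule measure_countable_Union_approachable[OF cE \<open>e > 0\<close> mE])
    fix D' assume "D' \<subseteq> E" "finite D'"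
    then show "measure lebesgue (\<Union>D') \<le> measure lebesgue (\<Union>E)"
      by (intro measure_mono_fmeasurable) (auto simp: mUE mE fmeasurableD intro!: sets.finite_Union)
  qed
  have mD: "\<Union>D \<in> lmeasurable"
    using D mE by (intro fmeasurable.finite_Union) auto
  have pw: "X \<inter> Y = {}" if XY: "X \<in> D" "Y \<in> D" "X \<noteq> Y" for X Y
  proof -
    obtain i j where ij: "i \<in> C" "j \<in> C" "X = {fst i..snd i}" "Y = {fst j..snd j}"
      using XY(1,2) D(1) unfolding E_def by blast
    then have "i \<noteq> j" using XY(3) by auto
    with C(3) ij(1,2) have "disjnt (cball (c i) (r i)) (cball (c j) (r j))"
      by (rule pairwiseD)
    then show ?thesis unfolding cb ij disjnt_def .
  qed
  \<comment> \<open>The discarded intervals, of total measure below \<open>e\<close>, and the null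
    set that the whole family misses.\<close>
  define W where "W = (\<Union>E - \<Union>D) \<union> (S - \<Union>E)"
  have neg': "negligible (S - \<Union>E)" using neg unfolding cb E_def by simp
  show ?thesis
  proof
    show "D division_of \<Union>D"
    proof (rule division_ofI)
      show "finite D" by fact
      fix X assume X: "X \<in> D"
      then obtain i where i: "i \<in> C" "X = {fst i..snd i}" using D(1) by (auto simp: E_def)
      show "X \<subseteq> \<Union>D" using X by auto
      show "X \<noteq> {}" using i C(2) by (force simp: K_def)
      show "\<exists>a b. X = cbox a b" using i by auto
      fix Y assume "Y \<in> D" "X \<noteq> Y"
      with X pw interior_subset show "interior X \<inter> interior Y = {}" by blast
    qed simp
    show "\<Union>D \<subseteq> U" using D CU by blast
    show "\<exists>u v. u < v \<and> X = {u..v} \<and> P u v" if "X \<in> D" for X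
      using that D(1) C(2) by (force simp: E_def K_def)
    have W1: "W \<in> lmeasurable" unfolding W_def
      by (intro fmeasurable.Un fmeasurable.Diff mUE mD negligible_imp_measurable neg' fmeasurableD)
    then show "W \<in> lmeasurable" .
    have "measure lebesgue W \<le> measure lebesgue (\<Union>E - \<Union>D) + measure lebesgue (S - \<Union>E)"
      unfolding W_def by (rule measure_Un_le) (auto simp: sE mD fmeasurableD negligible_imp_sets neg')
    also have "\<dots> = measure lebesgue (\<Union>E) - measure lebesgue (\<Union>D)"
      using D(1) by (subst measurable_measure_Diff) (auto simp: mUE mD fmeasurableD negligible_imp_measure0 neg')
    also have "\<dots> < e" using D by simp
    finally show "measure lebesgue W < e" .
    show "S \<subseteq> \<Union>D \<union> W" unfolding W_def by blast
  qed
qed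

lemma lmeasurable_outer_open:
  fixes S :: "real set"
  assumes "S \<in> lmeasurable" "e > 0"
  obtains T where "open T" "S \<subseteq> T" "T \<in> lmeasurable" "measure lebesgue T < measure lebesgue S + e"
proof -
  obtain T where T: "open T" "S \<subseteq> T" "T - S \<in> lmeasurable" "emeasure lebesgue (T - S) < ennreal e"
    using sets_lebesgue_outer_open[of S e] assms by (auto simp: fmeasurableD)
  have eq: "T = S \<union> (T - S)" using T(2) by blast
  have "measure lebesgue (T - S) < e"
    using T(3,4) assms(2) by (simp add: emeasure_eq_measure2 ennreal_less_iff)
  moreover have "measure lebesgue T \<le> measure lebesgue S + measure lebesgue (T - S)"
    using assms(1) T(3) by (subst eq, intro measure_Un_le) (auto simp: fmeasurableD)
  moreover have "T \<in> lmeasurable" using assms(1) T(3) by (subst eq) (rule fmeasurable.Un)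
  ultimately show thesis using T that by simp
qed

text \<open>Absolute continuity is stated with sums of lengths, while the covering arguments control
  Lebesgue measure. Intervals of a division overlap only in null sets, so the two agree.\<close>

lemma division_length:
  fixes D :: "real set set"
  assumes "D division_of T"
  shows "(\<Sum>K\<in>D. Sup K - Inf K) = measure lebesgue T"
proof -
  have *: "Sup K - Inf K = measure lebesgue K" if K: "K \<in> D" for K
  proof -
    obtain a b where "K = cbox a b" using division_ofD(4)[OF assms K] by blast
    with division_ofD(3)[OF assms K] show ?thesis by auto
  qed
  have "(\<Sum>K\<in>D. Sup K - Inf K) = (\<Sum>K\<in>D. measure lebesgue K)" using * by (rule sum.cong[OF refl])
  also have "\<dots> = measure lebesgue T"
    using content_division[OF assms] by simp
  finally show ?thesis .
qed

lemma division_increment: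
  fixes f :: "real \<Rightarrow> real"
  assumes "D division_of {a..b}" "a \<le> b"
  shows "(\<Sum>K\<in>D. f (Sup K) - f (Inf K)) = f b - f a"
proof -
  \<comment> \<open>The choice of tags is immaterial; left endpoints make the telescoping rule for
    tagged divisions applicable.\<close>
  define p where "p = (\<lambda>K. (Inf K, K)) ` D"
  note d = division_ofD[OF assms(1)]
  have "p tagged_division_of {a..b}"
  proof (rule tagged_division_ofI)
    fix x K assume "(x, K) \<in> p"
    then have K: "K \<in> D" "x = Inf K" by (auto simp: p_def)
    obtain u v where uv: "K = {u..v}" using d(4)[OF K(1)] by auto
    show "x \<in> K" using d(3)[OF K(1)] by (auto simp: K(2) uv)
  next
    fix x K y L assume "(x, K) \<in> p" "(y, L) \<in> p" "(x, K) \<noteq> (y, L)"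
    then show "interior K \<inter> interior L = {}" using d(5)[of K L] by (auto simp: p_def)
  next
    have "{K. \<exists>x. (x, K) \<in> p} = D" by (force simp: p_def)
    then show "\<Union>{K. \<exists>x. (x, K) \<in> p} = {a..b}" using d(6) by simp
  qed (use d(1,2,4) in \<open>auto simp: p_def\<close>)
  then have "(\<Sum>(x,K)\<in>p. f (Sup K) - f (Inf K)) = f b - f a"
    by (rule additive_tagged_division_1[OF assms(2)])
  also have "(\<Sum>(x,K)\<in>p. f (Sup K) - f (Inf K)) = (\<Sum>K\<in>D. f (Sup K) - f (Inf K))"
    unfolding p_def by (subst sum.reindex) (auto simp: inj_on_def)
  finally show ?thesis .
qed

subsection \<open>Absolutely continuous functions\<close>

lemma absolutely_continuous_on_intervalE:
  assumes "absolutely_continuous_on_interval a b f" "\<epsilon> > 0"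
  obtains \<delta> where "\<delta> > 0"
    "\<And>D. D division_of \<Union>D \<Longrightarrow> \<Union>D \<subseteq> {a..b} \<Longrightarrow> (\<Sum>K\<in>D. Sup K - Inf K) < \<delta> \<Longrightarrow>
        (\<Sum>K\<in>D. \<bar>f (Sup K) - f (Inf K)\<bar>) < \<epsilon>"
  using assms unfolding absolutely_continuous_on_interval_def by metis

section \<open>Differentiability almost everywhere\<close>

text \<open>On a piece of measure below \<open>\<delta>\<close>, absolute continuity keeps the
  summed increments over non-overlapping intervals below 1. Vitali intervals with slope at least
  \<open>2/e\<close> in absolute value then have total length below \<open>e/2\<close>, and a set of
  measure below \<open>e/2\<close> takes up the rest. Negligibility is local, so small pieces
  suffice.\<close>

lemma negligible_infinite_derivates:
  assumes ac: "absolutely_continuous_on_interval a b f"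
  shows "negligible {x \<in> {a<..<b}. \<forall>M d. 0 < d \<longrightarrow>
    (\<exists>u v. u < v \<and> x \<in> {u..v} \<and> v - u < d \<and> M * (v - u) \<le> \<bar>f v - f u\<bar>)}" (is "negligible ?S")
proof -
  obtain \<delta> where \<delta>: "\<delta> > 0"
    "\<And>D. D division_of \<Union>D \<Longrightarrow> \<Union>D \<subseteq> {a..b} \<Longrightarrow> (\<Sum>K\<in>D. Sup K - Inf K) < \<delta> \<Longrightarrow>
        (\<Sum>K\<in>D. \<bar>f (Sup K) - f (Inf K)\<bar>) < 1"
    using absolutely_continuous_on_intervalE[OF ac zero_less_one] by blast
  \<comment> \<open>The radius gives the ball length \<open>2/3 * \<delta>\<close>, so every
    division inside it meets the smallness condition.\<close>
  have loc: "negligible (?S \<inter> ball z (\<delta>/3))" for z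
    unfolding negligible_outer_le
  proof (intro allI impI)
    fix e :: real assume e: "e > 0"
    define U where "U = {a<..<b} \<inter> ball z (\<delta>/3)"
    have mU: "U \<in> lmeasurable" "measure lebesgue U < \<delta>"
    proof -
      show "U \<in> lmeasurable" unfolding U_def by (intro fmeasurable.Int) auto
      have "measure lebesgue U \<le> measure lebesgue (ball z (\<delta>/3))"
        unfolding U_def by (intro measure_mono_fmeasurable) auto
      also have "\<dots> < \<delta>" using \<delta>(1) by (simp add: ball_eq_greaterThanLessThan)
      finally show "measure lebesgue U < \<delta>" .
    qed
    obtain D W where D: "D division_of \<Union>D" "\<Union>D \<subseteq> U"
      "\<And>K. K \<in> D \<Longrightarrow> \<exists>u v. u < v \<and> K = {u..v} \<and> 2/e * (v - u) \<le> \<bar>f v - f u\<bar>"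
      and W: "W \<in> lmeasurable" "measure lebesgue W < e/2" "?S \<inter> ball z (\<delta>/3) \<subseteq> \<Union>D \<union> W"
    proof (rule Vitali_intervals_finite[of U "?S \<inter> ball z (\<delta>/3)" "e/2" "\<lambda>u v. 2/e * (v - u) \<le> \<bar>f v - f u\<bar>"])
      show "open U" "?S \<inter> ball z (\<delta>/3) \<subseteq> U" by (auto simp: U_def)
      show "\<exists>u v. u < v \<and> x \<in> {u..v} \<and> v - u < d \<and> 2/e * (v - u) \<le> \<bar>f v - f u\<bar>"
        if "x \<in> ?S \<inter> ball z (\<delta>/3)" "0 < d" for x d using that by blast
    qed (use mU e in auto)
    have mD: "\<Union>D \<in> lmeasurable" using D(1) by (rule lmeasurable_division)
    have len: "(\<Sum>K\<in>D. Sup K - Inf K) = measure lebesgue (\<Union>D)"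
      by (rule division_length[OF D(1)])
    have "measure lebesgue (\<Union>D) \<le> measure lebesgue U"
      using D(2) mU mD by (intro measure_mono_fmeasurable) (auto simp: fmeasurableD)
    then have "(\<Sum>K\<in>D. \<bar>f (Sup K) - f (Inf K)\<bar>) < 1"
      using D mU len by (intro \<delta>(2)) (auto simp: U_def)
    moreover have "(\<Sum>K\<in>D. 2/e * (Sup K - Inf K)) \<le> (\<Sum>K\<in>D. \<bar>f (Sup K) - f (Inf K)\<bar>)"
    proof (rule sum_mono)
      fix K assume "K \<in> D"
      from D(3)[OF this] show "2/e * (Sup K - Inf K) \<le> \<bar>f (Sup K) - f (Inf K)\<bar>" by auto
    qed
    ultimately have "2/e * measure lebesgue (\<Union>D) < 1"
      unfolding len[symmetric] by (simp add: sum_distrib_left)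
    then have "measure lebesgue (\<Union>D) < e/2" using e by (simp add: field_simps)
    moreover have "measure lebesgue (\<Union>D \<union> W) \<le> measure lebesgue (\<Union>D) + measure lebesgue W"
      using mD W by (intro measure_Un_le) (auto simp: fmeasurableD)
    ultimately have "measure lebesgue (\<Union>D \<union> W) \<le> e" using W by linarith
    then show "\<exists>T. ?S \<inter> ball z (\<delta>/3) \<subseteq> T \<and> T \<in> lmeasurable \<and> measure lebesgue T \<le> e"
      using W(3) fmeasurable.Un[OF mD W(1)] by blast
  qed
  show ?thesis
  proof (rule locally_negligible_alt[THEN iffD2], intro ballI exI conjI)
    fix z assume "z \<in> ?S"
    then show "z \<in> ?S \<inter> ball z (\<delta>/3)" using \<delta>(1) by simp
    show "openin (top_of_set ?S) (?S \<inter> ball z (\<delta>/3))" by (rule openin_open_Int[OF open_ball])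
    show "negligible (?S \<inter> ball z (\<delta>/3))" by (rule loc)
  qed
qed

text \<open>
  Let \<open>m\<close> be the outer measure of the exceptional set. Vitali's theorem covers almost all of it by
  intervals with slope at most \<open>r\<close>, of total length about \<open>m\<close>, and then again by intervals with slope at
  least \<open>s\<close> nested in the interiors of the former. What is left over of the first family has small total
  length, yet the increments of \<open>f\<close> over it sum to about \<open>- (s - r) * m\<close>, which absolute continuity forbids
  unless \<open>m = 0\<close>.
\<close>

lemma negligible_separated_derivates:
  assumes ac: "absolutely_continuous_on_interval a b f" and "r < s"
  shows "negligible {x \<in> {a<..<b}.
    (\<forall>d>0. \<exists>u v. u < v \<and> x \<in> {u..v} \<and> v - u < d \<and> f v - f u \<le> r * (v - u)) \<and>
    (\<forall>d>0. \<exists>u v. u < v \<and> x \<in> {u..v} \<and> v - u < d \<and> s * (v - u) \<le> f v - f u)}" (is "negligible ?S")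
proof (rule ccontr)
  define S where "S = ?S"
  assume "\<not> negligible ?S"
  then have nS: "\<not> negligible S" by (simp add: S_def)
  \<comment> \<open>Measurability of the exceptional set is not known, so its outer measure is taken
    as an infimum over measurable supersets; it is finite because \<open>{a<..<b}\<close> is one of
    them.\<close>
  define H where "H = {T. S \<subseteq> T \<and> T \<in> lmeasurable}"
  define m where "m = Inf (measure lebesgue ` H)"
  obtain e where e: "e > 0" "\<And>T. T \<in> H \<Longrightarrow> e < measure lebesgue T"
    using nS unfolding negligible_outer_le H_def by force
  have H0: "{a<..<b} \<in> H" by (auto simp: H_def S_def)
  have bdd: "bdd_below (measure lebesgue ` H)" by (rule bdd_belowI[of _ 0]) auto
  have "e \<le> m" unfolding m_def using H0 e(2) by (intro cINF_greatest) force+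
  then have m: "m > 0" using e(1) by simp
  have mle: "m \<le> measure lebesgue T" if "S \<subseteq> T" "T \<in> lmeasurable" for T
    unfolding m_def using that bdd by (intro cINF_lower) (auto simp: H_def)
  have "a < b"
  proof (rule ccontr)
    assume "\<not> a < b" then have "{a<..<b} = {}" by simp
    then have "S = {}" unfolding S_def by blast
    with nS show False by simp
  qed
  define k where "k = s - r"
  have k: "k > 0" using assms(2) by (simp add: k_def)
  have km: "k * m / 4 > 0" using k m by simp
  obtain \<delta> where \<delta>: "\<delta> > 0"
    "\<And>D. D division_of \<Union>D \<Longrightarrow> \<Union>D \<subseteq> {a..b} \<Longrightarrow> (\<Sum>K\<in>D. Sup K - Inf K) < \<delta> \<Longrightarrow>
        (\<Sum>K\<in>D. \<bar>f (Sup K) - f (Inf K)\<bar>) < k * m / 4"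
    using absolutely_continuous_on_intervalE[OF ac km] by blast
  \<comment> \<open>The leftover \<open>R\<close> will have length below \<open>3 * \<eta>\<close>.
    The three terms make absolute continuity apply to it, keep the measure of the second family
    above \<open>m / 2\<close>, and bound \<open>\<bar>r\<bar> * (4 * \<eta>)\<close> by
    \<open>k * m / 4\<close>; the summand 1 guards against \<open>r = 0\<close>.\<close>
  define \<eta> where "\<eta> = min (\<delta> / 4) (min (m / 4) (k * m / (16 * (\<bar>r\<bar> + 1))))"
  have \<eta>: "\<eta> > 0" "4 * \<eta> \<le> \<delta>" "4 * \<eta> \<le> m" using \<delta>(1) m k by (auto simp: \<eta>_def field_simps intro!: divide_pos_pos add_nonneg_pos)
  have "\<bar>r\<bar> * (4 * \<eta>) \<le> (\<bar>r\<bar> + 1) * (4 * (k * m / (16 * (\<bar>r\<bar> + 1))))"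
    using \<eta>(1) by (intro mult_mono) (auto simp: \<eta>_def)
  also have "\<dots> = k * m / 4" by (simp add: divide_simps)
  finally have \<eta>r: "\<bar>r\<bar> * (4 * \<eta>) \<le> k * m / 4" .
  obtain T where T: "T \<in> H" "measure lebesgue T < m + \<eta> / 2"
    using cINF_less_iff[of H "measure lebesgue" "m + \<eta> / 2"] H0 bdd \<eta>(1) unfolding m_def by auto
  define T' where "T' = T \<inter> {a<..<b}"
  have Sab: "S \<subseteq> {a<..<b}" by (auto simp: S_def)
  have T': "T' \<in> lmeasurable" "S \<subseteq> T'" using T Sab by (auto simp: T'_def H_def)
  have T'm: "measure lebesgue T' < m + \<eta> / 2"
    using T T' by (intro le_less_trans[OF measure_mono_fmeasurable[of T' T]]) (auto simp: T'_def H_def fmeasurableD)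
  obtain U' where U': "open U'" "T' \<subseteq> U'" "U' \<in> lmeasurable" "measure lebesgue U' < measure lebesgue T' + \<eta> / 2"
    using lmeasurable_outer_open[OF T'(1), of "\<eta>/2"] \<eta>(1) by auto
  define U where "U = U' \<inter> {a<..<b}"
  have U: "open U" "S \<subseteq> U" "U \<in> lmeasurable" using U' T' Sab by (auto simp: U_def)
  have Um: "measure lebesgue U < m + \<eta>"
    using U U' T'm by (intro le_less_trans[OF measure_mono_fmeasurable[of U U']]) (auto simp: U_def fmeasurableD)
  obtain D1 W1 where D1: "D1 division_of \<Union>D1" "\<Union>D1 \<subseteq> U"
      "\<And>K. K \<in> D1 \<Longrightarrow> \<exists>u v. u < v \<and> K = {u..v} \<and> f v - f u \<le> r * (v - u)"
      and W1: "W1 \<in> lmeasurable" "measure lebesgue W1 < \<eta>" "S \<subseteq> \<Union>D1 \<union> W1"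
  proof (rule Vitali_intervals_finite[of U S \<eta> "\<lambda>u v. f v - f u \<le> r * (v - u)"])
    show "\<exists>u v. u < v \<and> x \<in> {u..v} \<and> v - u < d \<and> f v - f u \<le> r * (v - u)"
      if "x \<in> S" "0 < d" for x d using that unfolding S_def by blast
  qed (use U \<eta>(1) in auto)
  have mD1: "\<Union>D1 \<in> lmeasurable" using D1(1) by (rule lmeasurable_division)
  have D1ab: "\<Union>D1 \<subseteq> {a..b}" using D1(2) by (auto simp: U_def)
  \<comment> \<open>The interior is open, as the second covering requires, and loses only endpoints
    of the first family, which are collected in \<open>N\<close> below.\<close>
  define U2 where "U2 = interior (\<Union>D1)"
  have U2: "open U2" "U2 \<in> lmeasurable" unfolding U2_def
    using mD1 by (auto intro!: fmeasurableI2[OF mD1 interior_subset])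
  obtain D2 W2 where D2: "D2 division_of \<Union>D2" "\<Union>D2 \<subseteq> U2"
      "\<And>K. K \<in> D2 \<Longrightarrow> \<exists>u v. u < v \<and> K = {u..v} \<and> s * (v - u) \<le> f v - f u"
      and W2: "W2 \<in> lmeasurable" "measure lebesgue W2 < \<eta>" "S \<inter> U2 \<subseteq> \<Union>D2 \<union> W2"
  proof (rule Vitali_intervals_finite[of U2 "S \<inter> U2" \<eta> "\<lambda>u v. s * (v - u) \<le> f v - f u"])
    show "\<exists>u v. u < v \<and> x \<in> {u..v} \<and> v - u < d \<and> s * (v - u) \<le> f v - f u"
      if "x \<in> S \<inter> U2" "0 < d" for x d using that unfolding S_def by blast
  qed (use U2 \<eta>(1) in auto)
  have mD2: "\<Union>D2 \<in> lmeasurable" using D2(1) by (rule lmeasurable_division)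
  define N where "N = (\<Union>K\<in>D1. K - interior K)"
  have N: "negligible N"
  proof -
    have "finite (K - interior K)" if K: "K \<in> D1" for K
    proof -
      obtain u v where "K = {u..v}" using D1(3)[OF K] by auto
      then have "K - interior K \<subseteq> {u, v}" by (auto simp: interior_atLeastAtMost_real)
      then show ?thesis by (rule finite_subset) auto
    qed
    then show ?thesis unfolding N_def using division_of_finite[OF D1(1)]
      by (intro negligible_finite) auto
  qed
  have "S \<subseteq> \<Union>D2 \<union> (W2 \<union> (W1 \<union> N))"
  proof
    fix x assume x: "x \<in> S"
    show "x \<in> \<Union>D2 \<union> (W2 \<union> (W1 \<union> N))"
    proof (cases "x \<in> U2")
      case True then show ?thesis using x W2(3) by blast
    next
      case False
      then have "x \<notin> interior K" if "K \<in> D1" for K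
        using that interior_mono[of K "\<Union>D1"] unfolding U2_def by blast
      with x W1(3) show ?thesis unfolding N_def by blast
    qed
  qed
  moreover have mN: "N \<in> lmeasurable" using N by (rule negligible_imp_measurable)
  ultimately have "m \<le> measure lebesgue (\<Union>D2 \<union> (W2 \<union> (W1 \<union> N)))"
    by (intro mle fmeasurable.Un mD2 W1(1) W2(1) mN)
  also have "\<dots> \<le> measure lebesgue (\<Union>D2) + (measure lebesgue W2 + (measure lebesgue W1 + measure lebesgue N))"
    by (intro order_trans[OF measure_Un_le] add_left_mono order_refl fmeasurableD fmeasurable.Un
          mD2 W1(1) W2(1) mN)
  finally have mD2': "m - 2 * \<eta> < measure lebesgue (\<Union>D2)"
    using W1(2) W2(2) negligible_imp_measure0[OF N] by linarith
  have mD12: "measure lebesgue (\<Union>D2) \<le> measure lebesgue (\<Union>D1)"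
    using D2(2) interior_subset mD1 mD2 unfolding U2_def
    by (intro measure_mono_fmeasurable) (auto simp: fmeasurableD)
  have mD1': "measure lebesgue (\<Union>D1) < m + \<eta>"
    using D1(2) U mD1 Um by (intro le_less_trans[OF measure_mono_fmeasurable[of "\<Union>D1" U]]) (auto simp: fmeasurableD)
  obtain q1 where q1: "D1 \<subseteq> q1" "q1 division_of {a..b}"
    using partial_division_extend_interval[OF D1(1), of a b] D1ab by auto
  \<comment> \<open>Keeping \<open>G\<close> as the common complement of \<open>D1\<close> in two divisions of \<open>{a..b}\<close> lets the increments
    of \<open>f\<close> over the leftover \<open>R\<close> telescope to those over \<open>D1\<close> minus those over \<open>D2\<close>.\<close>
  define G where "G = q1 - D1"
  have fq1: "finite q1" using q1(2) by (rule division_of_finite)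
  have Gd: "G division_of \<Union>G"
    unfolding G_def by (rule division_of_subset[OF division_of_union_self[OF q1(2)]]) auto
  have GD1: "interior (\<Union>D1) \<inter> interior (\<Union>G) = {}"
  proof (rule Int_interior_Union_intervals)
    show "finite G" using fq1 by (simp add: G_def)
    show "open (interior (\<Union>D1))" by simp
    fix K assume K: "K \<in> G"
    then show "\<exists>a b. K = cbox a b" using division_ofD(4)[OF Gd] by blast
    have "interior K \<inter> interior (\<Union>D1) = {}"
    proof (rule Int_interior_Union_intervals)
      show "finite D1" using division_of_finite[OF D1(1)] .
      show "\<exists>a b. T = cbox a b" if "T \<in> D1" for T using division_ofD(4)[OF D1(1)] that by blast
      show "interior K \<inter> interior T = {}" if "T \<in> D1" for T
        using division_ofD(5)[OF q1(2), of K T] K that q1(1) unfolding G_def by blast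
    qed auto
    then show "interior (\<Union>D1) \<inter> interior K = {}" by blast
  qed
  define P where "P = D2 \<union> G"
  have "interior (\<Union>D2) \<inter> interior (\<Union>G) = {}"
    using GD1 D2(2) interior_subset unfolding U2_def by blast
  then have Pd: "P division_of \<Union>P"
    using division_disjoint_union[OF D2(1) Gd] by (simp add: P_def)
  have D2G: "D2 \<inter> G = {}"
  proof (rule ccontr)
    assume "D2 \<inter> G \<noteq> {}"
    then obtain K where K: "K \<in> D2" "K \<in> G" by blast
    obtain u v where "u < v" "K = {u..v}" using D2(3)[OF K(1)] by auto
    then have "interior K \<noteq> {}" by (auto simp: interior_atLeastAtMost_real)
    moreover have "interior K \<subseteq> interior (\<Union>G)" using K(2) by (intro interior_mono) auto
    moreover have "interior K \<subseteq> interior (\<Union>D1)"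
      using K(1) D2(2) interior_subset[of K] unfolding U2_def by blast
    ultimately show False using GD1 by blast
  qed
  have "\<Union>P \<subseteq> cbox a b"
  proof -
    have "\<Union>D2 \<subseteq> {a..b}" using D2(2) D1ab interior_subset[of "\<Union>D1"] unfolding U2_def by blast
    moreover have "\<Union>G \<subseteq> {a..b}" using division_ofD(6)[OF q1(2)] unfolding G_def by blast
    ultimately show ?thesis unfolding P_def by auto
  qed
  then obtain q2 where q2: "P \<subseteq> q2" "q2 division_of {a..b}"
    using partial_division_extend_interval[OF Pd, of a b] by auto
  define R where "R = q2 - P"
  have fq2: "finite q2" using q2(2) by (rule division_of_finite)
  have Rd: "R division_of \<Union>R"
    unfolding R_def by (rule division_of_subset[OF division_of_union_self[OF q2(2)]]) auto
  \<comment> \<open>Taken with the identity this gives the length of the leftover, and with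
    \<open>f\<close> its total increment.\<close>
  have key: "(\<Sum>K\<in>R. F (Sup K) - F (Inf K)) = (\<Sum>K\<in>D1. F (Sup K) - F (Inf K)) - (\<Sum>K\<in>D2. F (Sup K) - F (Inf K))"
    for F :: "real \<Rightarrow> real"
  proof -
    define L where "L = (\<lambda>K. F (Sup K) - F (Inf K))"
    have "sum L q1 = F b - F a" "sum L q2 = F b - F a"
      unfolding L_def using division_increment q1(2) q2(2) \<open>a < b\<close> by (auto simp: less_imp_le)
    moreover have "sum L q1 = sum L D1 + sum L G" unfolding G_def
      using q1(1) fq1 by (subst sum.subset_diff[OF q1(1) fq1]) (simp add: add.commute)
    moreover have "sum L q2 = sum L R + sum L P" unfolding R_def
      by (rule sum.subset_diff[OF q2(1) fq2])
    moreover have "sum L P = sum L D2 + sum L G" unfolding P_def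
      using D2G division_of_finite[OF D2(1)] division_of_finite[OF Gd] by (intro sum.union_disjoint)
    ultimately show ?thesis unfolding L_def[symmetric] by linarith
  qed
  have l1: "(\<Sum>K\<in>D1. Sup K - Inf K) = measure lebesgue (\<Union>D1)" by (rule division_length[OF D1(1)])
  have l2: "(\<Sum>K\<in>D2. Sup K - Inf K) = measure lebesgue (\<Union>D2)" by (rule division_length[OF D2(1)])
  have "(\<Sum>K\<in>R. Sup K - Inf K) < \<delta>"
    using key[of "\<lambda>x. x"] mD1' mD2' \<eta> unfolding l1 l2 by linarith
  moreover have "\<Union>R \<subseteq> {a..b}" using division_ofD(6)[OF q2(2)] unfolding R_def by auto
  ultimately have "(\<Sum>K\<in>R. \<bar>f (Sup K) - f (Inf K)\<bar>) < k * m / 4" using Rd by (intro \<delta>(2))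
  then have "\<bar>\<Sum>K\<in>R. f (Sup K) - f (Inf K)\<bar> < k * m / 4"
    using sum_abs[of "\<lambda>K. f (Sup K) - f (Inf K)" R] by linarith
  \<comment> \<open>With \<open>m1\<close> and \<open>m2\<close> the measures of the two unions, the
    increment is at most \<open>r * m1 - s * m2 = r * (m1 - m2) - k * m2\<close>. The first term is
    at most \<open>k * m / 4\<close>, and \<open>m2\<close> is at least
    \<open>m / 2\<close>.\<close>
  moreover have "(\<Sum>K\<in>R. f (Sup K) - f (Inf K)) \<le> - (k * m / 4)"
  proof -
    have "(\<Sum>K\<in>D1. f (Sup K) - f (Inf K)) \<le> (\<Sum>K\<in>D1. r * (Sup K - Inf K))"
      using D1(3) by (intro sum_mono) force
    also have "\<dots> = r * measure lebesgue (\<Union>D1)" by (simp add: l1 sum_distrib_left[symmetric])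
    finally have a1: "(\<Sum>K\<in>D1. f (Sup K) - f (Inf K)) \<le> r * measure lebesgue (\<Union>D1)" .
    have "(\<Sum>K\<in>D2. s * (Sup K - Inf K)) \<le> (\<Sum>K\<in>D2. f (Sup K) - f (Inf K))"
      using D2(3) by (intro sum_mono) force
    then have a2: "s * measure lebesgue (\<Union>D2) \<le> (\<Sum>K\<in>D2. f (Sup K) - f (Inf K))"
      by (simp add: l2 sum_distrib_left[symmetric])
    have "r * (measure lebesgue (\<Union>D1) - measure lebesgue (\<Union>D2)) \<le> \<bar>r\<bar> * (4 * \<eta>)"
      using mD12 mD1' mD2' \<eta>(1) by (intro mult_mono) auto
    moreover have "k * (m / 2) \<le> k * measure lebesgue (\<Union>D2)"
      using mD2' \<eta>(3) k by (intro mult_left_mono) auto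
    moreover have "s * measure lebesgue (\<Union>D2) = r * measure lebesgue (\<Union>D2) + k * measure lebesgue (\<Union>D2)"
      by (simp add: k_def algebra_simps)
    ultimately show ?thesis using a1 a2 \<eta>r unfolding key[of f] by (simp add: algebra_simps)
  qed
  ultimately show False by linarith
qed

text \<open>The limit is the supremum of the eventual strict lower bounds \<open>A\<close>. For
  \<open>c\<close> above it, two rationals fit strictly between; the smaller is not in
  \<open>A\<close>, so separation makes the larger an eventual upper bound. Asking for rational
  pairs only keeps the exceptional sets countable in number.\<close>

lemma bounded_separated_imp_tendsto:
  fixes q :: "'a \<Rightarrow> real"
  assumes "F \<noteq> bot" "eventually (\<lambda>h. \<bar>q h\<bar> \<le> M) F"
    and sep: "\<And>r s. r < s \<Longrightarrow> r \<in> \<rat> \<Longrightarrow> s \<in> \<rat> \<Longrightarrow> eventually (\<lambda>h. r < q h) F \<or> eventually (\<lambda>h. q h < s) F"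
  shows "\<exists>L. (q \<longlongrightarrow> L) F"
proof -
  define A where "A = {r. eventually (\<lambda>h. r < q h) F}"
  have ne: "- M - 1 \<in> A" unfolding A_def using assms(2) by (auto elim: eventually_mono)
  have bdd: "bdd_above A"
  proof (rule bdd_aboveI)
    fix r assume "r \<in> A"
    then have "eventually (\<lambda>h. r \<le> M) F"
      using assms(2) unfolding A_def by (auto elim: eventually_elim2)
    then show "r \<le> M" using assms(1) by simp
  qed
  have "(q \<longlongrightarrow> Sup A) F"
  proof (rule order_tendstoI)
    fix c assume "c < Sup A"
    then obtain r where r: "r \<in> A" "c < r" using less_cSup_iff[OF _ bdd] ne by blast
    then show "eventually (\<lambda>h. c < q h) F" unfolding A_def by (auto elim: eventually_mono)
  next
    fix c assume "Sup A < c"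
    obtain s where s: "s \<in> \<rat>" "Sup A < s" "s < c" using Rats_dense_in_real[OF \<open>Sup A < c\<close>] by blast
    obtain r where r: "r \<in> \<rat>" "Sup A < r" "r < s" using Rats_dense_in_real[OF s(2)] by blast
    have "r \<notin> A" using r(2) cSup_upper[OF _ bdd] by force
    then have "eventually (\<lambda>h. q h < s) F" using sep[OF r(3,1) s(1)] by (auto simp: A_def)
    then show "eventually (\<lambda>h. q h < c) F" using s(3) by (auto elim: eventually_mono)
  qed
  then show ?thesis ..
qed

text \<open>Swapping the endpoints for negative \<open>h\<close> leaves the slope unchanged. This
  connects the derivative with slopes over intervals that contain \<open>x\<close>.\<close>

lemma difference_quotient_interval:
  fixes f :: "real \<Rightarrow> real"
  assumes "h \<noteq> 0"
  obtains u v where "u < v" "x \<in> {u..v}" "v - u = \<bar>h\<bar>" "f v - f u = (f (x + h) - f x) / h * (v - u)"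
proof (cases "h > 0")
  case True
  then show ?thesis by (intro that[of x "x + h"]) auto
next
  case False
  with assms show ?thesis by (intro that[of "x + h" x]) (auto simp: field_simps)
qed

text \<open>Off the first exceptional set the difference quotients are bounded near 0. Off the sets
  for rational \<open>r < s\<close> they cannot keep falling to \<open>r\<close> or below and rising
  to \<open>s\<close> or above. Both together force convergence, and only countably many null sets
  are removed.\<close>

lemma absolutely_continuous_on_interval_differentiable_ae:
  assumes ac: "absolutely_continuous_on_interval a b f"
  shows "negligible {x \<in> {a<..<b}. \<not> f differentiable (at x)}"
proof -
  define S where "S = {x \<in> {a<..<b}. \<forall>M d. 0 < d \<longrightarrow>
    (\<exists>u v. u < v \<and> x \<in> {u..v} \<and> v - u < d \<and> M * (v - u) \<le> \<bar>f v - f u\<bar>)}"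
  define T where "T = (\<lambda>(r, s). {x \<in> {a<..<b}.
    (\<forall>d>0. \<exists>u v. u < v \<and> x \<in> {u..v} \<and> v - u < d \<and> f v - f u \<le> r * (v - u)) \<and>
    (\<forall>d>0. \<exists>u v. u < v \<and> x \<in> {u..v} \<and> v - u < d \<and> s * (v - u) \<le> f v - f u)})"
  define I where "I = {(r, s). r \<in> \<rat> \<and> s \<in> \<rat> \<and> r < (s :: real)}"
  have "countable I"
    by (rule countable_subset[of _ "\<rat> \<times> \<rat>"]) (auto simp: I_def countable_rat)
  have "negligible (\<Union>(T ` I))"
  proof (rule negligible_countable_Union)
    show "countable (T ` I)" using \<open>countable I\<close> by simp
    show "negligible X" if "X \<in> T ` I" for X
      using that negligible_separated_derivates[OF ac] by (auto simp: I_def T_def)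
  qed
  moreover have "negligible S" unfolding S_def by (rule negligible_infinite_derivates[OF ac])
  ultimately have neg: "negligible (S \<union> \<Union>(T ` I))" by (intro negligible_Un)
  have "f differentiable (at x)" if x: "x \<in> {a<..<b}" "x \<notin> S" "x \<notin> \<Union>(T ` I)" for x
  proof -
    define q where "q = (\<lambda>h. (f (x + h) - f x) / h)"
    \<comment> \<open>A property of the slopes over all short intervals containing \<open>x\<close>
      passes to the difference quotients.\<close>
    have ev: "eventually (\<lambda>h. Q (q h)) (at 0)"
      if d: "d > 0" "\<And>u v. u < v \<Longrightarrow> x \<in> {u..v} \<Longrightarrow> v - u < d \<Longrightarrow> Q ((f v - f u) / (v - u))" for Q d
      unfolding eventually_at
    proof (intro exI conjI ballI impI)
      fix h :: real assume h: "h \<noteq> 0 \<and> dist h 0 < d"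
      obtain u v where uv: "u < v" "x \<in> {u..v}" "v - u = \<bar>h\<bar>" "f v - f u = q h * (v - u)"
        unfolding q_def using difference_quotient_interval[of h x f] h by blast
      have "Q ((f v - f u) / (v - u))" using uv h by (intro d(2)) auto
      then show "Q (q h)" using uv(1,4) by simp
    qed (rule d(1))
    obtain M d where Md: "d > 0" "\<And>u v. u < v \<Longrightarrow> x \<in> {u..v} \<Longrightarrow> v - u < d \<Longrightarrow> \<bar>f v - f u\<bar> < M * (v - u)"
      using x(1,2) unfolding S_def mem_Collect_eq not_le[symmetric] by blast
    have b: "eventually (\<lambda>h. \<bar>q h\<bar> \<le> M) (at 0)"
    proof (rule ev[OF Md(1)])
      fix u v assume "u < v" "x \<in> {u..v}" "v - u < d"
      then show "\<bar>(f v - f u) / (v - u)\<bar> \<le> M" using Md(2)[of u v] by (simp add: abs_divide divide_le_eq)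
    qed
    have sep: "eventually (\<lambda>h. r < q h) (at 0) \<or> eventually (\<lambda>h. q h < s) (at 0)"
      if rs: "r < s" "r \<in> \<rat>" "s \<in> \<rat>" for r s
    proof -
      have "x \<notin> T (r, s)" using x(3) rs by (auto simp: I_def)
      then consider d where "d > 0" "\<And>u v. u < v \<Longrightarrow> x \<in> {u..v} \<Longrightarrow> v - u < d \<Longrightarrow> r * (v - u) < f v - f u"
        | d where "d > 0" "\<And>u v. u < v \<Longrightarrow> x \<in> {u..v} \<Longrightarrow> v - u < d \<Longrightarrow> f v - f u < s * (v - u)"
        using x(1) unfolding T_def mem_Collect_eq prod.case not_le[symmetric] by blast
      then show ?thesis
      proof cases
        case 1
        have "eventually (\<lambda>h. r < q h) (at 0)"
          by (rule ev[OF 1(1)]) (use 1(2) in \<open>simp add: less_divide_eq\<close>)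
        then show ?thesis ..
      next
        case 2
        have "eventually (\<lambda>h. q h < s) (at 0)"
          by (rule ev[OF 2(1)]) (use 2(2) in \<open>simp add: divide_less_eq\<close>)
        then show ?thesis ..
      qed
    qed
    obtain L where "(q \<longlongrightarrow> L) (at 0)"
      using bounded_separated_imp_tendsto[OF _ b sep] by auto
    then have "(f has_real_derivative L) (at x)" by (simp add: DERIV_def q_def)
    then show ?thesis by (auto simp: real_differentiable_def)
  qed
  then have "{x \<in> {a<..<b}. \<not> f differentiable (at x)} \<subseteq> S \<union> \<Union>(T ` I)" by blast
  with neg show ?thesis by (rule negligible_subset)
qed

section \<open>Increments as integrals of the derivative\<close>

text \<open>The errors of the linear approximation from \<open>t\<close> to \<open>v\<close> and
  from \<open>u\<close> to \<open>t\<close> are at most \<open>e * (v - t)\<close> and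
  \<open>e * (t - u)\<close>. Because \<open>t\<close> lies between \<open>u\<close> and
  \<open>v\<close>, they add up to the right-hand side.\<close>

lemma derivative_straddle:
  fixes f :: "real \<Rightarrow> real"
  assumes "(f has_real_derivative D) (at t)" "e > 0"
  obtains d where "d > 0" "\<And>u v. u \<le> t \<Longrightarrow> t \<le> v \<Longrightarrow> {u..v} \<subseteq> ball t d \<Longrightarrow> \<bar>f v - f u - D * (v - u)\<bar> \<le> e * (v - u)"
proof -
  have "(f has_derivative (*) D) (at t)" using assms(1) by (simp add: has_field_derivative_def)
  then obtain d where d: "d > 0" "\<And>w. \<bar>w - t\<bar> < d \<Longrightarrow> \<bar>f w - f t - D * (w - t)\<bar> \<le> e * \<bar>w - t\<bar>"
    using assms(2) unfolding has_derivative_at_alt real_norm_def by blast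
  show thesis
  proof (rule that[OF d(1)])
    fix u v assume uv: "u \<le> t" "t \<le> v" "{u..v} \<subseteq> ball t d"
    then have "u \<in> ball t d" "v \<in> ball t d" by (meson atLeastAtMost_iff order_refl order_trans subsetD)+
    then have "\<bar>f v - f t - D * (v - t)\<bar> \<le> e * \<bar>v - t\<bar>" "\<bar>f u - f t - D * (u - t)\<bar> \<le> e * \<bar>u - t\<bar>"
      by (auto intro!: d(2) simp: dist_real_def)
    with uv show "\<bar>f v - f u - D * (v - u)\<bar> \<le> e * (v - u)" by (simp add: algebra_simps)
  qed
qed

text \<open>The error of a Riemann sum is split by its tags. Where \<open>f\<close> is
  differentiable, the straddle estimate contributes at most \<open>\<epsilon>\<close> times the
  length. The remaining tags lie in a null set, where the integrand is set to 0, and only the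
  increments of \<open>f\<close> over intervals of small total length are left.\<close>

lemma absolutely_continuous_on_interval_FTC:
  assumes ac: "absolutely_continuous_on_interval a b f" and "a \<le> x" "x \<le> y" "y \<le> b"
  shows "(deriv f has_integral f y - f x) {x..y}"
proof -
  \<comment> \<open>Nothing is known about \<open>f\<close> outside \<open>{a..b}\<close>, so the
    two-sided derivative may fail to exist at the endpoints; \<open>N\<close> then contains
    them.\<close>
  define N where "N = {z \<in> {a..b}. \<not> f differentiable (at z)}"
  have N: "negligible N"
  proof (rule negligible_subset)
    show "negligible ({z \<in> {a<..<b}. \<not> f differentiable (at z)} \<union> {a, b})"
      using absolutely_continuous_on_interval_differentiable_ae[OF ac] by (intro negligible_Un) auto
  qed (auto simp: N_def)
  define h where "h = (\<lambda>z. if z \<in> N then 0 else deriv f z)"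
  have "(h has_integral f y - f x) (cbox x y)"
    unfolding has_integral
  proof (intro allI impI)
    fix e :: real assume e: "e > 0"
    \<comment> \<open>The summand 1 keeps the denominator positive when
      \<open>x = y\<close>.\<close>
    define \<epsilon> where "\<epsilon> = e / (2 * (y - x + 1))"
    have \<epsilon>: "\<epsilon> > 0" "\<epsilon> * (y - x) < e / 2" using e assms by (auto simp: \<epsilon>_def field_simps)
    have e2: "e / 2 > 0" using e by simp
    obtain \<delta> where \<delta>: "\<delta> > 0"
      "\<And>D. D division_of \<Union>D \<Longrightarrow> \<Union>D \<subseteq> {a..b} \<Longrightarrow> (\<Sum>K\<in>D. Sup K - Inf K) < \<delta> \<Longrightarrow>
        (\<Sum>K\<in>D. \<bar>f (Sup K) - f (Inf K)\<bar>) < e / 2"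
      using absolutely_continuous_on_intervalE[OF ac e2] by blast
    obtain U where U: "open U" "N \<subseteq> U" "U \<in> lmeasurable" "measure lebesgue U < \<delta>"
      using lmeasurable_outer_open[OF negligible_imp_measurable[OF N] \<delta>(1)] negligible_imp_measure0[OF N] by auto
    have "\<exists>d>0. \<forall>u v. u \<le> t \<longrightarrow> t \<le> v \<longrightarrow> {u..v} \<subseteq> ball t d \<longrightarrow> \<bar>f v - f u - h t * (v - u)\<bar> \<le> \<epsilon> * (v - u)"
      if t: "t \<in> {a..b} - N" for t
    proof -
      have "(f has_real_derivative h t) (at t)"
        using t by (auto simp: N_def h_def real_differentiable_def DERIV_imp_deriv)
      from derivative_straddle[OF this \<epsilon>(1)] show ?thesis by metis
    qed
    then obtain d where d: "\<And>t. t \<in> {a..b} - N \<Longrightarrow> d t > 0"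
      "\<And>t u v. t \<in> {a..b} - N \<Longrightarrow> u \<le> t \<Longrightarrow> t \<le> v \<Longrightarrow> {u..v} \<subseteq> ball t (d t) \<Longrightarrow>
        \<bar>f v - f u - h t * (v - u)\<bar> \<le> \<epsilon> * (v - u)"
      by metis
    \<comment> \<open>Tags in \<open>N\<close> are confined to an open set too small for \<open>f\<close> to vary on; at all other tags the
      straddle inequality applies.\<close>
    define \<gamma> where "\<gamma> = (\<lambda>t. if t \<in> N then U else if t \<in> {a..b} then ball t (d t) else ball t 1)"
    have \<gamma>: "gauge \<gamma>" unfolding gauge_def \<gamma>_def using U(1,2) d(1) by auto
    have riem: "norm ((\<Sum>(t,K)\<in>p. Henstock_Kurzweil_Integration.content K *\<^sub>R h t) - (f y - f x)) < e"
      if p: "p tagged_division_of cbox x y" "\<gamma> fine p" for p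
    proof -
      note pd = tagged_division_ofD[OF p(1)]
      have iv: "\<exists>u v. K = {u..v} \<and> u \<le> t \<and> t \<le> v \<and> {u..v} \<subseteq> \<gamma> t \<and> t \<in> {a..b}" if tK: "(t, K) \<in> p" for t K
      proof -
        obtain u v where uv: "K = cbox u v" using pd(4)[OF tK] by blast
        moreover have "t \<in> K" "K \<subseteq> cbox x y" using pd(2,3)[OF tK] by auto
        moreover have "K \<subseteq> \<gamma> t" using p(2) tK by (auto simp: fine_def)
        ultimately show ?thesis using assms by auto
      qed
      define pN where "pN = {(t, K) \<in> p. t \<in> N}"
      have pN: "pN \<subseteq> p" by (auto simp: pN_def)
      have "pN tagged_partial_division_of cbox x y"
        by (rule tagged_partial_division_subset[OF _ pN]) (use p(1) in \<open>simp add: tagged_division_of_def\<close>)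
      then have pNd: "pN tagged_division_of \<Union>(snd ` pN)"
        by (rule tagged_partial_division_of_Union_self)
      then have Dd: "snd ` pN division_of \<Union>(snd ` pN)" by (rule division_of_tagged_division)
      have DU: "\<Union>(snd ` pN) \<subseteq> U"
      proof safe
        fix z t K assume "(t, K) \<in> pN" "z \<in> snd (t, K)"
        then show "z \<in> U" using iv[of t K] by (auto simp: pN_def \<gamma>_def)
      qed
      have "(\<Sum>K\<in>snd ` pN. Sup K - Inf K) = measure lebesgue (\<Union>(snd ` pN))"
        by (rule division_length[OF Dd])
      also have "\<dots> \<le> measure lebesgue U"
        using DU U(3) lmeasurable_division[OF Dd] by (intro measure_mono_fmeasurable) (auto simp: fmeasurableD)
      finally have "(\<Sum>K\<in>snd ` pN. Sup K - Inf K) < \<delta>" using U(4) by simp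
      moreover have "\<Union>(snd ` pN) \<subseteq> {a..b}"
        using pd(3) pN assms by fastforce
      ultimately have "(\<Sum>K\<in>snd ` pN. \<bar>f (Sup K) - f (Inf K)\<bar>) < e / 2" by (intro \<delta>(2) Dd)
      moreover have "(\<Sum>(t,K)\<in>pN. \<bar>f (Sup K) - f (Inf K)\<bar>) = (\<Sum>K\<in>snd ` pN. \<bar>f (Sup K) - f (Inf K)\<bar>)"
      proof -
        \<comment> \<open>An interval with two tags has empty interior, hence is a single point and
          has increment zero. The summation rule also asks for the value at the empty box, where
          \<open>Sup\<close> and \<open>Inf\<close> mean nothing; \<open>L\<close> is set to 0
          there.\<close>
        define L where "L = (\<lambda>K. if K = {} then 0 else \<bar>f (Sup K) - f (Inf K)\<bar>)"
        have "L K = \<bar>f (Sup K) - f (Inf K)\<bar>" if "K \<in> snd ` pN" for K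
          using division_ofD(3)[OF Dd that] by (simp add: L_def)
        moreover have "(\<Sum>(t,K)\<in>pN. L K) = (\<Sum>K\<in>snd ` pN. L K)"
          by (rule sum.over_tagged_division_lemma[OF pNd]) (auto simp: L_def)
        ultimately show ?thesis by (force simp: case_prod_unfold intro: sum.cong)
      qed
      ultimately have sN: "(\<Sum>(t,K)\<in>pN. \<bar>f (Sup K) - f (Inf K)\<bar>) < e / 2" by simp
      \<comment> \<open>The error of one tagged interval; for a tag in \<open>N\<close> it is just
        minus the increment of \<open>f\<close>.\<close>
      define E where "E = (\<lambda>(t,K). Henstock_Kurzweil_Integration.content K * h t - (f (Sup K) - f (Inf K)))"
      have EN: "(\<Sum>z\<in>pN. \<bar>E z\<bar>) < e / 2"
        using sN by (subst sum.cong[OF refl, of _ _ "\<lambda>(t,K). \<bar>f (Sup K) - f (Inf K)\<bar>"]) (auto simp: pN_def E_def h_def)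
      have "(\<Sum>z\<in>p - pN. \<bar>E z\<bar>) \<le> (\<Sum>(t,K)\<in>p - pN. \<epsilon> * Henstock_Kurzweil_Integration.content K)"
      proof (rule sum_mono, safe)
        fix t K assume tK: "(t, K) \<in> p" "(t, K) \<notin> pN"
        obtain u v where uv: "K = {u..v}" "u \<le> t" "t \<le> v" "{u..v} \<subseteq> \<gamma> t" "t \<in> {a..b}"
          using iv[OF tK(1)] by blast
        have "t \<notin> N" using tK by (auto simp: pN_def)
        with d(2)[of t u v] uv have "\<bar>f v - f u - h t * (v - u)\<bar> \<le> \<epsilon> * (v - u)" by (auto simp: \<gamma>_def)
        with uv show "\<bar>E (t, K)\<bar> \<le> \<epsilon> * Henstock_Kurzweil_Integration.content K"
          by (simp add: E_def mult.commute abs_minus_commute)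
      qed
      also have "\<dots> \<le> (\<Sum>(t,K)\<in>p. \<epsilon> * Henstock_Kurzweil_Integration.content K)"
        using pd(1) \<epsilon>(1) by (intro sum_mono2) auto
      also have "\<dots> = \<epsilon> * (y - x)"
        using additive_content_tagged_division[OF p(1)] assms
        by (simp add: sum_distrib_left[symmetric] case_prod_unfold)
      finally have "(\<Sum>z\<in>p - pN. \<bar>E z\<bar>) < e / 2" using \<epsilon>(2) by linarith
      moreover have "(\<Sum>z\<in>p. \<bar>E z\<bar>) = (\<Sum>z\<in>p - pN. \<bar>E z\<bar>) + (\<Sum>z\<in>pN. \<bar>E z\<bar>)"
        by (rule sum.subset_diff[OF pN pd(1)])
      ultimately have "(\<Sum>z\<in>p. \<bar>E z\<bar>) < e" using EN by linarith
      then have "\<bar>\<Sum>z\<in>p. E z\<bar> < e" using sum_abs[of E p] by linarith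
      moreover have "(\<Sum>(t,K)\<in>p. f (Sup K) - f (Inf K)) = f y - f x"
        using additive_tagged_division_1[OF assms(3)] p(1) by simp
      ultimately show ?thesis
        by (simp add: E_def case_prod_unfold sum_subtractf)
    qed
    show "\<exists>\<gamma>. gauge \<gamma> \<and> (\<forall>\<D>. \<D> tagged_division_of cbox x y \<and> \<gamma> fine \<D> \<longrightarrow>
        norm ((\<Sum>(t,K)\<in>\<D>. Henstock_Kurzweil_Integration.content K *\<^sub>R h t) - (f y - f x)) < e)" using \<gamma> riem by (intro exI[of _ \<gamma>] conjI allI impI) simp_all
  qed
  then have "(deriv f has_integral f y - f x) (cbox x y)"
    by (rule has_integral_spike[OF N, rotated]) (auto simp: h_def)
  then show ?thesis by simp
qed

subsection \<open>Integral inequalities\<close>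

lemma integrable_times_bounded:
  fixes h w :: "'a \<Rightarrow> real"
  assumes "integrable M h" "w \<in> borel_measurable M" "\<And>x. x \<in> space M \<Longrightarrow> \<bar>w x\<bar> \<le> C"
  shows "integrable M (\<lambda>x. h x * w x)"
proof (rule Bochner_Integration.integrable_bound)
  show "integrable M (\<lambda>x. C * h x)" using assms(1) by simp
  show "(\<lambda>x. h x * w x) \<in> borel_measurable M" using assms by measurable
  show "AE x in M. norm (h x * w x) \<le> norm (C * h x)"
  proof (rule AE_I2)
    fix x assume "x \<in> space M"
    then have "\<bar>h x\<bar> * \<bar>w x\<bar> \<le> \<bar>h x\<bar> * \<bar>C\<bar>" using assms(3)[of x] by (intro mult_left_mono) auto
    then show "norm (h x * w x) \<le> norm (C * h x)" by (simp add: abs_mult mult.commute)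
  qed
qed

text \<open>The exchange of integrals below takes place in the completed measure, so
  sigma-finiteness is needed for \<open>lebesgue\<close> itself.\<close>

lemma sigma_finite_lebesgue: "sigma_finite_measure (lebesgue :: real measure)"
proof
  show "\<exists>A::real set set. countable A \<and> A \<subseteq> sets lebesgue \<and> \<Union>A = space lebesgue \<and> (\<forall>a\<in>A. emeasure lebesgue a \<noteq> \<infinity>)"
  proof (intro exI[of _ "range (\<lambda>n::nat. {- real n..real n})"] conjI ballI)
    have "x \<in> {- real (nat \<lceil>\<bar>x\<bar>\<rceil>)..real (nat \<lceil>\<bar>x\<bar>\<rceil>)}" for x :: real
      using of_nat_ceiling[of "\<bar>x\<bar>"] unfolding atLeastAtMost_iff by linarith
    then have "\<Union>(range (\<lambda>n::nat. {- real n..real n})) = UNIV" by blast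
    then show "\<Union>(range (\<lambda>n::nat. {- real n..real n})) = space lebesgue"
      unfolding space_completion space_lborel space_borel .
    fix X assume "X \<in> range (\<lambda>n::nat. {- real n..real n})"
    then show "emeasure lebesgue X \<noteq> \<infinity>" by (auto simp: emeasure_lborel_Icc_eq)
  qed auto
qed

section \<open>The weighted estimate for the difference\<close>

text \<open>Here \<open>k\<close> stands for the absolute derivative, and \<open>w\<close> is the
  smaller of two majorants of the exact weight. For fixed \<open>x\<close>, the weight integrates
  \<open>\<bar>s\<bar>\<close> over the points \<open>t\<close> with \<open>x\<close> between
  \<open>t\<close> and \<open>c\<close>. Those points within \<open>{a..b}\<close> fill an interval
  of length \<open>x - a\<close> or \<open>b - x\<close> on which \<open>\<bar>s\<bar>\<close> is at
  most 1, and the whole mass of \<open>\<bar>s\<bar>\<close> on either side of \<open>c\<close>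
  equals the integral of \<open>g\<close> over \<open>{c..b}\<close>.\<close>

lemma Steffensen_difference_bound:
  fixes f g k :: "real \<Rightarrow> real" and a b c :: real
  defines "w \<equiv> \<lambda>x. min (LINT t:{c..b}|lebesgue. g t) (if x \<le> c then x - a else b - x)"
  assumes abc: "a \<le> c" "c \<le> b"
    and f: "set_integrable lebesgue {a..b} f"
    and g: "set_integrable lebesgue {a..b} g"
    and g01: "\<And>t. t \<in> {a..b} \<Longrightarrow> 0 \<le> g t \<and> g t \<le> 1"
    and c: "c - a = (LINT t:{a..b}|lebesgue. g t)"
    and k: "set_integrable lebesgue {a..b} k" "\<And>x. 0 \<le> k x"
    and fk: "\<And>x y. a \<le> x \<Longrightarrow> x \<le> y \<Longrightarrow> y \<le> b \<Longrightarrow> \<bar>f y - f x\<bar> \<le> (LINT z:{x..y}|lebesgue. k z)"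
  shows "set_integrable lebesgue {a..b} (\<lambda>x. k x * w x)"
    and "\<bar>(LINT t:{a..c}|lebesgue. f t) - (LINT t:{a..b}|lebesgue. f t * g t)\<bar>
        \<le> (LINT x:{a..b}|lebesgue. k x * w x)"
proof -
  define F where "F = (\<lambda>t. indicat_real {a..b} t * f t)"
  define g1 where "g1 = (\<lambda>t. indicat_real {a..b} t * g t)"
  define k1 where "k1 = (\<lambda>t. indicat_real {a..b} t * k t)"
  have iF: "integrable lebesgue F" and ig: "integrable lebesgue g1" and ik: "integrable lebesgue k1"
    using f g k(1) by (auto simp: set_integrable_def F_def g1_def k1_def)
  note [measurable] = borel_measurable_integrable[OF iF] borel_measurable_integrable[OF ig] borel_measurable_integrable[OF ik]
  have g1: "0 \<le> g1 t" "g1 t \<le> 1" for t using g01[of t] by (auto simp: g1_def indicator_def)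
  have lint: "integrable lebesgue (\<lambda>t. indicat_real {x..y} t * h t)"
    "(LINT t:{x..y}|lebesgue. h t) = (\<integral>t. indicat_real {x..y} t * h t \<partial>lebesgue)"
    if "set_integrable lebesgue {a..b} h" "a \<le> x" "y \<le> b" for x y h
    using set_integrable_subset[OF that(1), of "{x..y}"] that
    by (auto simp: set_integrable_def set_lebesgue_integral_def)
  \<comment> \<open>The point \<open>c\<close> belongs to both closed pieces, and at
    \<open>x = c\<close> the kernel \<open>J\<close> below is 1 for every \<open>t\<close>; both
    effects are discarded as null.\<close>
  have AEc: "AE t in lebesgue. t \<noteq> c"
    using AE_lborel_singleton[of c] by (rule AE_completion)
  define B where "B = (LINT t:{c..b}|lebesgue. g t)"
  define s where "s = (\<lambda>t. indicat_real {a..b} t * indicat_real {..c} t - g1 t)"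
  have indc: "indicat_real {a..b} t * indicat_real {..c} t = indicat_real {a..c} t" for t
    using abc by (auto simp: indicator_def)
  have ii: "integrable lebesgue (\<lambda>t. indicat_real {a..b} t * indicat_real {..c} t)"
    unfolding indc by (intro integrable_real_indicator) (auto simp: emeasure_lborel_Icc_eq)
  have s_int: "integrable lebesgue s" unfolding s_def using ii ig by (rule Bochner_Integration.integrable_diff)
  note [measurable] = borel_measurable_integrable[OF s_int]
  have s0: "(\<integral>t. s t \<partial>lebesgue) = 0"
  proof -
    have "(\<integral>t. s t \<partial>lebesgue) = (\<integral>t. indicat_real {a..b} t * indicat_real {..c} t \<partial>lebesgue) - (\<integral>t. g1 t \<partial>lebesgue)"
      unfolding s_def by (rule Bochner_Integration.integral_diff[OF ii ig])
    also have "\<dots> = 0" using c abc unfolding indc by (simp add: g1_def set_lebesgue_integral_def)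
    finally show ?thesis .
  qed
  have s1: "\<bar>s t\<bar> \<le> 1" for t using g1[of t] by (auto simp: s_def indicator_def)
  have s_eq: "s t = (if t \<in> {a..c} then 1 - g t else if t \<in> {c<..b} then - g t else 0)" for t
    using abc by (auto simp: s_def g1_def indicator_def)
  \<comment> \<open>Both sides of \<open>c\<close> carry the same mass: \<open>c - a\<close> is the
    integral of \<open>g\<close> over \<open>{a..b}\<close>, so what \<open>g\<close> lacks to 1 on
    \<open>{a..c}\<close> is what it has on \<open>{c..b}\<close>.\<close>
  have B: "(\<integral>t. indicat_real {a..c} t * (1 - g t) \<partial>lebesgue) = B"
    "integrable lebesgue (\<lambda>t. indicat_real {a..c} t * (1 - g t))"
  proof -
    have gac: "integrable lebesgue (\<lambda>t. indicat_real {a..c} t * g t)" "integrable lebesgue (\<lambda>t. indicat_real {c..b} t * g t)"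
      using lint(1)[OF g] abc by auto
    have i1: "integrable lebesgue (indicat_real {a..c})" using ii unfolding indc .
    have eq: "indicat_real {a..c} t * (1 - g t) = indicat_real {a..c} t - indicat_real {a..c} t * g t" for t
      by (simp add: algebra_simps)
    show "integrable lebesgue (\<lambda>t. indicat_real {a..c} t * (1 - g t))"
      unfolding eq using i1 gac by simp
    have "(\<integral>t. indicat_real {a..c} t * (1 - g t) \<partial>lebesgue) = (c - a) - (\<integral>t. indicat_real {a..c} t * g t \<partial>lebesgue)"
      unfolding eq using i1 gac abc by (subst Bochner_Integration.integral_diff) auto
    moreover have "(\<integral>t. indicat_real {a..b} t * g t \<partial>lebesgue) =
      (\<integral>t. indicat_real {a..c} t * g t + indicat_real {c..b} t * g t \<partial>lebesgue)"
    proof (rule integral_cong_AE)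
      show "(\<lambda>t. indicat_real {a..b} t * g t) \<in> borel_measurable lebesgue"
        using ig unfolding g1_def by (rule borel_measurable_integrable)
      show "(\<lambda>t. indicat_real {a..c} t * g t + indicat_real {c..b} t * g t) \<in> borel_measurable lebesgue"
        using gac by (intro borel_measurable_add borel_measurable_integrable)
      show "AE t in lebesgue. indicat_real {a..b} t * g t = indicat_real {a..c} t * g t + indicat_real {c..b} t * g t"
        using AEc by eventually_elim (use abc in \<open>auto simp: indicator_def\<close>)
    qed
    ultimately show "(\<integral>t. indicat_real {a..c} t * (1 - g t) \<partial>lebesgue) = B"
      using c lint(2)[OF g] gac abc by (simp add: B_def)
  qed
  have B0: "B \<ge> 0" unfolding B(1)[symmetric]
    using g01 abc by (intro Bochner_Integration.integral_nonneg) (auto simp: indicator_def)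
  have w0: "0 \<le> w x" if "x \<in> {a..b}" for x using that B0 unfolding w_def B_def by auto
  have wm: "w \<in> borel_measurable lebesgue"
    unfolding w_def by (rule measurable_completion) measurable
  have ikw: "integrable lebesgue (\<lambda>x. k1 x * w x)"
  proof -
    \<comment> \<open>\<open>w\<close> is bounded by \<open>b - a\<close> only on
      \<open>{a..b}\<close>; the indicator needed for this is absorbed by the one in
      \<open>k1\<close>.\<close>
    have "integrable lebesgue (\<lambda>x. k1 x * (indicat_real {a..b} x * w x))"
    proof (rule integrable_times_bounded[OF ik, of _ "b - a"])
      show "\<bar>indicat_real {a..b} x * w x\<bar> \<le> b - a" for x
        using w0[of x] abc by (auto simp: indicator_def w_def)
      show "(\<lambda>x. indicat_real {a..b} x * w x) \<in> borel_measurable lebesgue"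
        by (intro borel_measurable_times wm borel_measurable_indicator) auto
    qed
    also have "(\<lambda>x. k1 x * (indicat_real {a..b} x * w x)) = (\<lambda>x. k1 x * w x)"
      by (auto simp: k1_def indicator_def)
    finally show ?thesis .
  qed
  then show "set_integrable lebesgue {a..b} (\<lambda>x. k x * w x)"
    by (simp add: set_integrable_def k1_def mult.assoc)
  \<comment> \<open>The indicator of \<open>x\<close> lying between \<open>t\<close> and
    \<open>c\<close>, which encodes the moving limits of integration so that the integrals can be
    exchanged.\<close>
  define J :: "real \<Rightarrow> real \<Rightarrow> ennreal" where "J = (\<lambda>t x. if t \<le> x \<and> x \<le> c \<or> c \<le> x \<and> x \<le> t then 1 else 0)"
  have ifs: "integrable lebesgue (\<lambda>t. (f t - f c) * s t)" and
    D: "(LINT t:{a..c}|lebesgue. f t) - (LINT t:{a..b}|lebesgue. f t * g t) = (\<integral>t. (f t - f c) * s t \<partial>lebesgue)"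
  proof -
    \<comment> \<open>\<open>s\<close> vanishes outside \<open>{a..b}\<close>, so the cut-off
      \<open>F\<close> may replace \<open>f\<close>; the term with \<open>f c\<close> disappears
      because \<open>s\<close> has integral zero.\<close>
    have eq: "(f t - f c) * s t = F t * s t - f c * s t" for t
      by (auto simp: F_def s_def g1_def indicator_def algebra_simps)
    have i1: "integrable lebesgue (\<lambda>t. F t * s t)"
      by (rule integrable_times_bounded[OF iF, of _ 1]) (auto simp: s1)
    show "integrable lebesgue (\<lambda>t. (f t - f c) * s t)" unfolding eq using i1 s_int by simp
    have i2: "integrable lebesgue (\<lambda>t. F t * g1 t)"
      by (rule integrable_times_bounded[OF iF, of _ 1]) (auto simp: g1)
    have i3: "integrable lebesgue (\<lambda>t. indicat_real {a..c} t * f t)" using lint(1)[OF f] abc by auto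
    have "(\<integral>t. (f t - f c) * s t \<partial>lebesgue) = (\<integral>t. F t * s t \<partial>lebesgue)"
      unfolding eq using i1 s_int s0 by simp
    also have "(\<lambda>t. F t * s t) = (\<lambda>t. indicat_real {a..c} t * f t - F t * g1 t)"
      using abc by (auto simp: F_def s_def g1_def indicator_def algebra_simps)
    also have "(\<integral>t. indicat_real {a..c} t * f t - F t * g1 t \<partial>lebesgue)
      = (\<integral>t. indicat_real {a..c} t * f t \<partial>lebesgue) - (\<integral>t. F t * g1 t \<partial>lebesgue)"
      using i3 i2 by simp
    also have "(\<lambda>t. F t * g1 t) = (\<lambda>t. indicat_real {a..b} t * (f t * g t))"
      by (auto simp: F_def g1_def indicator_def)
    finally show "(LINT t:{a..c}|lebesgue. f t) - (LINT t:{a..b}|lebesgue. f t * g t) = (\<integral>t. (f t - f c) * s t \<partial>lebesgue)"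
      by (simp add: set_lebesgue_integral_def)
  qed
  have fJ: "ennreal \<bar>f t - f c\<bar> \<le> (\<integral>\<^sup>+x. ennreal (k1 x) * J t x \<partial>lebesgue)" if t: "t \<in> {a..b}" for t
  proof -
    define x where "x = min t c"
    define y where "y = max t c"
    have xy: "a \<le> x" "x \<le> y" "y \<le> b" using t abc by (auto simp: x_def y_def)
    have "\<bar>f t - f c\<bar> \<le> (LINT z:{x..y}|lebesgue. k z)"
      using fk[OF xy] by (auto simp: x_def y_def min_def max_def abs_minus_commute split: if_splits)
    then have "ennreal \<bar>f t - f c\<bar> \<le> ennreal (\<integral>z. indicat_real {x..y} z * k z \<partial>lebesgue)"
      using lint(2)[OF k(1), of x y] xy by (intro ennreal_leI) simp
    also have "\<dots> = (\<integral>\<^sup>+z. ennreal (indicat_real {x..y} z * k z) \<partial>lebesgue)"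
      using lint(1)[OF k(1), of x y] xy k(2) by (intro nn_integral_eq_integral[symmetric]) auto
    also have "\<dots> \<le> (\<integral>\<^sup>+x. ennreal (k1 x) * J t x \<partial>lebesgue)"
      using xy by (intro nn_integral_mono) (auto simp: k1_def J_def indicator_def x_def y_def)
    finally show ?thesis .
  qed
  have "ennreal \<bar>\<integral>t. (f t - f c) * s t \<partial>lebesgue\<bar> \<le> (\<integral>\<^sup>+t. ennreal \<bar>(f t - f c) * s t\<bar> \<partial>lebesgue)"
    using integral_norm_bound_ennreal[OF ifs] by simp
  also have "\<dots> \<le> (\<integral>\<^sup>+t. \<integral>\<^sup>+x. ennreal \<bar>s t\<bar> * (ennreal (k1 x) * J t x) \<partial>lebesgue \<partial>lebesgue)"
  proof (rule nn_integral_mono)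
    fix t
    have "ennreal \<bar>(f t - f c) * s t\<bar> = ennreal \<bar>s t\<bar> * ennreal \<bar>f t - f c\<bar>"
      by (simp add: abs_mult ennreal_mult'' mult.commute)
    also have "\<dots> \<le> ennreal \<bar>s t\<bar> * (\<integral>\<^sup>+x. ennreal (k1 x) * J t x \<partial>lebesgue)"
      using fJ[of t] s_eq[of t] abc by (cases "t \<in> {a..b}") (auto intro!: mult_left_mono)
    also have "\<dots> = (\<integral>\<^sup>+x. ennreal \<bar>s t\<bar> * (ennreal (k1 x) * J t x) \<partial>lebesgue)"
    proof (rule nn_integral_cmult[symmetric])
      have [measurable]: "J t \<in> borel_measurable lebesgue"
        unfolding J_def by (rule measurable_completion) measurable
      show "(\<lambda>x. ennreal (k1 x) * J t x) \<in> borel_measurable lebesgue" by measurable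
    qed
    finally show "ennreal \<bar>(f t - f c) * s t\<bar> \<le> (\<integral>\<^sup>+x. ennreal \<bar>s t\<bar> * (ennreal (k1 x) * J t x) \<partial>lebesgue)" .
  qed
  also have "\<dots> = (\<integral>\<^sup>+x. \<integral>\<^sup>+t. ennreal \<bar>s t\<bar> * (ennreal (k1 x) * J t x) \<partial>lebesgue \<partial>lebesgue)"
  proof -
    interpret sigma_finite_measure "lebesgue :: real measure" by (rule sigma_finite_lebesgue)
    interpret pair_sigma_finite "lebesgue :: real measure" "lebesgue :: real measure" ..
    \<comment> \<open>For nonnegative integrands the exchange needs only joint measurability. For
      \<open>J\<close> this comes from measurability of the coordinates with respect to the product
      of completed measures.\<close>
    have idm: "(\<lambda>x::real. x) \<in> borel_measurable lebesgue" by (rule measurable_completion) measurable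
    have [measurable]: "fst \<in> borel_measurable (lebesgue \<Otimes>\<^sub>M (lebesgue :: real measure) :: (real \<times> real) measure)"
      by (rule measurable_compose[OF measurable_fst idm])
    have [measurable]: "snd \<in> borel_measurable (lebesgue \<Otimes>\<^sub>M (lebesgue :: real measure) :: (real \<times> real) measure)"
      by (rule measurable_compose[OF measurable_snd idm])
    have [measurable]: "(\<lambda>p. J (snd p) (fst p)) \<in> borel_measurable (lebesgue \<Otimes>\<^sub>M lebesgue)"
      unfolding J_def by measurable
    have "(\<lambda>p. ennreal \<bar>s (snd p)\<bar> * (ennreal (k1 (fst p)) * J (snd p) (fst p))) \<in> borel_measurable (lebesgue \<Otimes>\<^sub>M lebesgue)"
      by measurable
    then show ?thesis using Fubini' [of "\<lambda>x t. ennreal \<bar>s t\<bar> * (ennreal (k1 x) * J t x)"]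
      by (simp add: case_prod_unfold)
  qed
  also have "\<dots> \<le> (\<integral>\<^sup>+x. ennreal (k1 x * w x) \<partial>lebesgue)"
  proof (rule nn_integral_mono_AE)
    show "AE x in lebesgue. (\<integral>\<^sup>+t. ennreal \<bar>s t\<bar> * (ennreal (k1 x) * J t x) \<partial>lebesgue) \<le> ennreal (k1 x * w x)"
      using AEc
    proof eventually_elim
      case (elim x)
      show ?case
      proof (cases "x \<in> {a..b}")
        case False
        then show ?thesis by (simp add: k1_def)
      next
        case x: True
        have *: "(\<integral>\<^sup>+t. ennreal \<bar>s t\<bar> * J t x \<partial>lebesgue) \<le> ennreal (w x)"
        proof -
          have m1: "(\<integral>\<^sup>+t. ennreal \<bar>s t\<bar> * J t x \<partial>lebesgue) \<le> ennreal (if x \<le> c then x - a else b - x)"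
          proof -
            have "(\<integral>\<^sup>+t. ennreal \<bar>s t\<bar> * J t x \<partial>lebesgue) \<le> (\<integral>\<^sup>+t. indicator (if x \<le> c then {a..x} else {x..b}) t \<partial>lebesgue)"
            proof (rule nn_integral_mono)
              fix t show "ennreal \<bar>s t\<bar> * J t x \<le> indicator (if x \<le> c then {a..x} else {x..b}) t"
                using elim x abc s1[of t] s_eq[of t] by (auto simp: J_def indicator_def)
            qed
            also have "\<dots> = ennreal (if x \<le> c then x - a else b - x)" using x by (subst nn_integral_indicator) auto
            finally show ?thesis .
          qed
          moreover have "(\<integral>\<^sup>+t. ennreal \<bar>s t\<bar> * J t x \<partial>lebesgue) \<le> ennreal B"
          proof (cases "x \<le> c")
            case True
            have "(\<integral>\<^sup>+t. ennreal \<bar>s t\<bar> * J t x \<partial>lebesgue) \<le> (\<integral>\<^sup>+t. ennreal (indicat_real {a..c} t * (1 - g t)) \<partial>lebesgue)"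
            proof (rule nn_integral_mono)
              fix t show "ennreal \<bar>s t\<bar> * J t x \<le> ennreal (indicat_real {a..c} t * (1 - g t))"
                using elim x True abc g01[of t] s_eq[of t] by (auto simp: J_def indicator_def)
            qed
            also have "\<dots> = ennreal B"
              using B g01 abc by (subst nn_integral_eq_integral) (auto simp: indicator_def intro!: AE_I2)
            finally show ?thesis .
          next
            case False
            have "(\<integral>\<^sup>+t. ennreal \<bar>s t\<bar> * J t x \<partial>lebesgue) \<le> (\<integral>\<^sup>+t. ennreal (indicat_real {c..b} t * g t) \<partial>lebesgue)"
            proof (rule nn_integral_mono)
              fix t show "ennreal \<bar>s t\<bar> * J t x \<le> ennreal (indicat_real {c..b} t * g t)"
                using elim x False abc g01[of t] s_eq[of t] by (auto simp: J_def indicator_def)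
            qed
            also have "\<dots> = ennreal B"
              using lint[OF g, of c b] g01 abc
              by (subst nn_integral_eq_integral) (auto simp: indicator_def B_def intro!: AE_I2)
            finally show ?thesis .
          qed
          ultimately show ?thesis unfolding w_def B_def[symmetric] by (auto simp: min_def)
        qed
        have [measurable]: "(\<lambda>t. J t x) \<in> borel_measurable lebesgue"
          unfolding J_def by (rule measurable_completion) measurable
        have "(\<integral>\<^sup>+t. ennreal \<bar>s t\<bar> * (ennreal (k1 x) * J t x) \<partial>lebesgue) = (\<integral>\<^sup>+t. ennreal (k1 x) * (ennreal \<bar>s t\<bar> * J t x) \<partial>lebesgue)"
          by (simp add: mult_ac)
        also have "\<dots> = ennreal (k1 x) * (\<integral>\<^sup>+t. ennreal \<bar>s t\<bar> * J t x \<partial>lebesgue)"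
          by (rule nn_integral_cmult) measurable
        also have "\<dots> \<le> ennreal (k1 x) * ennreal (w x)" by (intro mult_left_mono *) auto
        also have "\<dots> = ennreal (k1 x * w x)" using k(2) x by (subst ennreal_mult) (auto simp: k1_def w0)
        finally show ?thesis .
      qed
    qed
  qed
  also have "\<dots> = ennreal (\<integral>x. k1 x * w x \<partial>lebesgue)"
    using k(2) w0 by (intro nn_integral_eq_integral[OF ikw] AE_I2) (auto simp: k1_def indicator_def)
  finally have "\<bar>\<integral>t. (f t - f c) * s t \<partial>lebesgue\<bar> \<le> (\<integral>x. k1 x * w x \<partial>lebesgue)"
    using k(2) w0 by (subst (asm) ennreal_le_iff) (auto simp: k1_def indicator_def intro!: Bochner_Integration.integral_nonneg)
  then show "\<bar>(LINT t:{a..c}|lebesgue. f t) - (LINT t:{a..b}|lebesgue. f t * g t)\<bar>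
        \<le> (LINT x:{a..b}|lebesgue. k x * w x)"
    unfolding D by (simp add: set_lebesgue_integral_def k1_def mult.assoc)
qed

section \<open>Hoelder's inequality and powers of ramps\<close>

text \<open>Young's inequality is applied to \<open>u\<close> and \<open>v\<close> divided by their
  norms and then integrated. If one norm is 0, normalisation is impossible, but then the product
  vanishes almost everywhere.\<close>

lemma Hoelder_inequality:
  fixes u v :: "'a \<Rightarrow> real"
  assumes r: "1 < r" "1 / r + 1 / q = 1"
    and u: "u \<in> borel_measurable M" "\<And>x. 0 \<le> u x" "integrable M (\<lambda>x. u x powr r)"
    and v: "v \<in> borel_measurable M" "\<And>x. 0 \<le> v x" "integrable M (\<lambda>x. v x powr q)"
  shows "integrable M (\<lambda>x. u x * v x)"
    and "(\<integral>x. u x * v x \<partial>M) \<le> (\<integral>x. u x powr r \<partial>M) powr (1 / r) * (\<integral>x. v x powr q \<partial>M) powr (1 / q)"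
proof -
  have q: "1 < q"
  proof -
    have "1 / r < 1" "0 < 1 / r" using r(1) by auto
    then have "0 < 1 / q" "1 / q < 1" using r(2) by linarith+
    then show ?thesis by (simp add: divide_less_eq split: if_splits)
  qed
  have Young: "s * t \<le> s powr r / r + t powr q / q" if "0 \<le> s" "0 \<le> t" for s t
    using Youngs_inequality[OF r(1) q r(2) that] .
  show int: "integrable M (\<lambda>x. u x * v x)"
  proof (rule Bochner_Integration.integrable_bound)
    show "integrable M (\<lambda>x. u x powr r / r + v x powr q / q)" using u(3) v(3) by simp
    show "(\<lambda>x. u x * v x) \<in> borel_measurable M" using u(1) v(1) by measurable
    show "AE x in M. norm (u x * v x) \<le> norm (u x powr r / r + v x powr q / q)"
    proof (rule AE_I2)
      fix x show "norm (u x * v x) \<le> norm (u x powr r / r + v x powr q / q)"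
        using Young[OF u(2) v(2), of x x] u(2)[of x] v(2)[of x] by simp
    qed
  qed
  define A where "A = (\<integral>x. u x powr r \<partial>M)"
  define B where "B = (\<integral>x. v x powr q \<partial>M)"
  have AB: "A \<ge> 0" "B \<ge> 0" unfolding A_def B_def by (auto intro!: Bochner_Integration.integral_nonneg)
  show "(\<integral>x. u x * v x \<partial>M) \<le> A powr (1 / r) * B powr (1 / q)"
  proof (cases "A = 0 \<or> B = 0")
    case True
    then have "AE x in M. u x * v x = 0"
    proof
      assume "A = 0"
      then have "AE x in M. u x powr r = 0"
        unfolding A_def using u(3) by (subst (asm) integral_nonneg_eq_0_iff_AE) auto
      then show ?thesis by eventually_elim auto
    next
      assume "B = 0"
      then have "AE x in M. v x powr q = 0"
        unfolding B_def using v(3) by (subst (asm) integral_nonneg_eq_0_iff_AE) auto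
      then show ?thesis by eventually_elim auto
    qed
    then have "(\<integral>x. u x * v x \<partial>M) = 0" by (rule integral_eq_zero_AE)
    then show ?thesis using AB by simp
  next
    case False
    with AB have pos: "A > 0" "B > 0" by auto
    define \<alpha> where "\<alpha> = A powr (1 / r)"
    define \<beta> where "\<beta> = B powr (1 / q)"
    have ab: "\<alpha> > 0" "\<beta> > 0" "\<alpha> powr r = A" "\<beta> powr q = B"
      using pos r(1) q by (auto simp: \<alpha>_def \<beta>_def powr_powr)
    have pw: "u x * v x \<le> \<alpha> * \<beta> * (u x powr r / (r * A) + v x powr q / (q * B))" for x
    proof -
      have "(u x / \<alpha>) * (v x / \<beta>) \<le> (u x / \<alpha>) powr r / r + (v x / \<beta>) powr q / q"
        using u(2)[of x] v(2)[of x] ab by (intro Young) auto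
      also have "\<dots> = u x powr r / (r * A) + v x powr q / (q * B)"
        using u(2)[of x] v(2)[of x] ab by (simp add: powr_divide mult.commute)
      finally have "\<alpha> * \<beta> * ((u x / \<alpha>) * (v x / \<beta>)) \<le> \<alpha> * \<beta> * (u x powr r / (r * A) + v x powr q / (q * B))"
        using ab by (intro mult_left_mono) auto
      then show ?thesis using ab by simp
    qed
    have "(\<integral>x. u x * v x \<partial>M) \<le> (\<integral>x. \<alpha> * \<beta> * (u x powr r / (r * A) + v x powr q / (q * B)) \<partial>M)"
      using int u(3) v(3) pw by (intro integral_mono) auto
    also have "\<dots> = \<alpha> * \<beta> * (A / (r * A) + B / (q * B))"
      using u(3) v(3) by (simp add: A_def B_def)
    also have "\<dots> = \<alpha> * \<beta>" using pos r(2) by simp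
    finally show ?thesis by (simp add: \<alpha>_def \<beta>_def)
  qed
qed

text \<open>The indicator stands inside the power because the cut-off ramp is the function put into
  Hoelder's inequality; as \<open>0 powr q = 0\<close>, it can be pulled out.\<close>

lemma integral_ramp_powr:
  fixes a b q :: real
  assumes "a \<le> b" "0 < q"
  shows "integrable lebesgue (\<lambda>x. (indicat_real {a..b} x * (x - a)) powr q)"
    and "(\<integral>x. (indicat_real {a..b} x * (x - a)) powr q \<partial>lebesgue) = (b - a) powr (q + 1) / (q + 1)"
    and "integrable lebesgue (\<lambda>x. (indicat_real {a..b} x * (b - x)) powr q)"
    and "(\<integral>x. (indicat_real {a..b} x * (b - x)) powr q \<partial>lebesgue) = (b - a) powr (q + 1) / (q + 1)"
proof -
  \<comment> \<open>The derivative rule for real powers needs a positive base; at the endpoint where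
    the base is 0, continuity suffices.\<close>
  have "((\<lambda>x. (x - a) powr q) has_integral (b - a) powr (q + 1) / (q + 1) - (a - a) powr (q + 1) / (q + 1)) {a..b}"
    using assms
    by (intro fundamental_theorem_of_calculus_interior)
       (auto intro!: continuous_intros continuous_on_powr' derivative_eq_intros
         simp: has_real_derivative_iff_has_vector_derivative[symmetric])
  then have i1: "integral {a..b} (\<lambda>x. (x - a) powr q) = (b - a) powr (q + 1) / (q + 1)"
    using assms by (simp add: integral_unique)
  have "((\<lambda>x. (b - x) powr q) has_integral - ((b - b) powr (q + 1)) / (q + 1) - (- ((b - a) powr (q + 1)) / (q + 1))) {a..b}"
    using assms
    by (intro fundamental_theorem_of_calculus_interior)
       (auto intro!: continuous_intros continuous_on_powr' derivative_eq_intros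
         simp: has_real_derivative_iff_has_vector_derivative[symmetric])
  then have i2: "integral {a..b} (\<lambda>x. (b - x) powr q) = (b - a) powr (q + 1) / (q + 1)"
    using assms by (simp add: integral_unique)
  have s1: "set_integrable lebesgue {a..b} (\<lambda>x. (x - a) powr q)"
    and s2: "set_integrable lebesgue {a..b} (\<lambda>x. (b - x) powr q)"
    using assms by (auto intro!: absolutely_integrable_continuous_real continuous_intros continuous_on_powr')
  have e: "(indicat_real {a..b} x * y) powr q = indicat_real {a..b} x * y powr q" for x y
    by (auto simp: indicator_def)
  show "integrable lebesgue (\<lambda>x. (indicat_real {a..b} x * (x - a)) powr q)"
    "integrable lebesgue (\<lambda>x. (indicat_real {a..b} x * (b - x)) powr q)"
    using s1 s2 by (simp_all add: e set_integrable_def)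
  show "(\<integral>x. (indicat_real {a..b} x * (x - a)) powr q \<partial>lebesgue) = (b - a) powr (q + 1) / (q + 1)"
    "(\<integral>x. (indicat_real {a..b} x * (b - x)) powr q \<partial>lebesgue) = (b - a) powr (q + 1) / (q + 1)"
    using set_lebesgue_integral_eq_integral(2)[OF s1] set_lebesgue_integral_eq_integral(2)[OF s2] i1 i2
    by (simp_all add: e set_lebesgue_integral_def)
qed

lemma in_Lp_infinity_AE:
  assumes "in_Lp \<infinity> S h" "S \<in> sets lebesgue"
  shows "AE x in lebesgue. x \<in> S \<longrightarrow> \<bar>h x\<bar> \<le> Lp_norm \<infinity> S h"
proof -
  define E where "E = esssup (lebesgue_on S) (\<lambda>x. ereal \<bar>h x\<bar>)"
  have "E < \<infinity>" using assms(1) by (simp add: in_Lp_def E_def)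
  have "AE x in lebesgue_on S. ereal \<bar>h x\<bar> \<le> E" unfolding E_def by (rule esssup_AE)
  then have "AE x in lebesgue. x \<in> S \<longrightarrow> ereal \<bar>h x\<bar> \<le> E"
    using assms(2) by (subst (asm) AE_restrict_space_iff) auto
  then show ?thesis
  proof eventually_elim
    case (elim x)
    \<comment> \<open>If \<open>E\<close> is minus infinity, no \<open>x\<close> in \<open>S\<close>
      satisfies the bound, so the default value of \<open>real_of_ereal\<close> does no
      harm.\<close>
    then show ?case using \<open>E < \<infinity>\<close> by (cases E) (auto simp: Lp_norm_def E_def[symmetric])
  qed
qed

text \<open>The interval has finite measure, so an essential bound, or
  \<open>1 + \<bar>h x\<bar> powr r\<close> for a finite exponent, is an integrable
  majorant.\<close>

lemma in_Lp_imp_integrable: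
  fixes h :: "real \<Rightarrow> real"
  assumes h: "in_Lp p {a..b} h" and p: "1 \<le> p"
  shows "set_integrable lebesgue {a..b} h"
proof -
  have hm: "(\<lambda>x. indicat_real {a..b} x *\<^sub>R h x) \<in> borel_measurable lebesgue"
    using h by (subst borel_measurable_restrict_space_iff[symmetric]) (auto simp: in_Lp_def)
  have i1: "integrable lebesgue (indicat_real {a..b})"
    by (intro integrable_real_indicator) (auto simp: emeasure_lborel_Icc_eq)
  show ?thesis
  proof (cases "p = \<infinity>")
    case True
    define C where "C = Lp_norm \<infinity> {a..b} h"
    have AE: "AE x in lebesgue. x \<in> {a..b} \<longrightarrow> \<bar>h x\<bar> \<le> C"
      unfolding C_def using h True by (intro in_Lp_infinity_AE) auto
    show ?thesis unfolding set_integrable_def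
    proof (rule Bochner_Integration.integrable_bound[OF _ hm])
      show "integrable lebesgue (\<lambda>x. indicat_real {a..b} x * C)" using i1 by simp
      show "AE x in lebesgue. norm (indicat_real {a..b} x *\<^sub>R h x) \<le> norm (indicat_real {a..b} x * C)"
        using AE by eventually_elim (auto simp: indicator_def)
    qed
  next
    case False
    then obtain r where r: "p = ereal r" "1 \<le> r" using p by (cases p) (auto simp: one_ereal_def)
    have ir: "integrable lebesgue (\<lambda>x. indicat_real {a..b} x * \<bar>h x\<bar> powr r)"
      using h False r by (simp add: in_Lp_def set_integrable_def)
    show ?thesis unfolding set_integrable_def
    proof (rule Bochner_Integration.integrable_bound[OF _ hm])
      show "integrable lebesgue (\<lambda>x. indicat_real {a..b} x + indicat_real {a..b} x * \<bar>h x\<bar> powr r)" using i1 ir by simp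
      show "AE x in lebesgue. norm (indicat_real {a..b} x *\<^sub>R h x)
          \<le> norm (indicat_real {a..b} x + indicat_real {a..b} x * \<bar>h x\<bar> powr r)"
      proof (rule AE_I2)
        fix x
        have "\<bar>h x\<bar> \<le> 1 + \<bar>h x\<bar> powr r"
        proof (cases "\<bar>h x\<bar> \<le> 1")
          case False
          then have "\<bar>h x\<bar> powr 1 \<le> \<bar>h x\<bar> powr r" using r by (intro powr_mono) auto
          then show ?thesis by simp
        qed (simp add: add_increasing2)
        then show "norm (indicat_real {a..b} x *\<^sub>R h x)
          \<le> norm (indicat_real {a..b} x + indicat_real {a..b} x * \<bar>h x\<bar> powr r)"
          by (auto simp: indicator_def)
      qed
    qed
  qed
qed

lemma absolutely_continuous_on_interval_increment_le:
  assumes ac: "absolutely_continuous_on_interval a b f" and h: "set_integrable lebesgue {a..b} (deriv f)"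
    and xy: "a \<le> x" "x \<le> y" "y \<le> b"
  shows "\<bar>f y - f x\<bar> \<le> (LINT z:{x..y}|lebesgue. \<bar>deriv f z\<bar>)"
proof -
  have "set_integrable lebesgue {x..y} (deriv f)"
    by (rule set_integrable_subset[OF h]) (use xy in auto)
  \<comment> \<open>Absolute integrability turns the Henstock-Kurzweil integral of the derivative
    into a Lebesgue integral.\<close>
  moreover from this have "(LINT z:{x..y}|lebesgue. deriv f z) = f y - f x"
    using absolutely_continuous_on_interval_FTC[OF ac xy]
    by (simp add: set_lebesgue_integral_eq_integral(2) integral_unique)
  ultimately show ?thesis using set_integral_norm_bound[of lebesgue "{x..y}" "deriv f"] by simp
qed

section \<open>The three bounds for the first difference\<close>

text \<open>The constant majorant \<open>B\<close> of the weight gives the bound with the 1-norm.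
  The other two use the ramps \<open>v1\<close> and \<open>v2\<close>, whose sum dominates the
  weight on \<open>{a..b}\<close>. Hoelder's inequality is applied to each ramp separately, hence
  the sum of two powers.\<close>

lemma Steffensen_deviation_bounds:
  fixes f g :: "real \<Rightarrow> real" and a b lam :: real
  assumes f: "set_integrable lebesgue {a..b} f"
    and g: "set_integrable lebesgue {a..b} g"
    and g01: "\<And>t. t \<in> {a..b} \<Longrightarrow> 0 \<le> g t \<and> g t \<le> 1"
    and lam: "lam = (LINT t:{a..b}|lebesgue. g t)" "0 \<le> lam" "lam \<le> b - a"
    and ac: "absolutely_continuous_on_interval a b f"
    and h: "set_integrable lebesgue {a..b} (deriv f)"
  defines "D \<equiv> \<bar>(LINT t:{a..a + lam}|lebesgue. f t) - (LINT t:{a..b}|lebesgue. f t * g t)\<bar>"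
  shows "in_Lp \<infinity> {a..b} (deriv f) \<Longrightarrow> D \<le> 1 / 2 * (lam\<^sup>2 + (b - a - lam)\<^sup>2) * Lp_norm \<infinity> {a..b} (deriv f)"
    and "1 < r \<Longrightarrow> 1 / r + 1 / q = 1 \<Longrightarrow> in_Lp (ereal r) {a..b} (deriv f) \<Longrightarrow>
        D \<le> Lp_norm (ereal r) {a..b} (deriv f) / (q + 1) powr (1 / q) *
            (lam powr ((q + 1) / q) + (b - a - lam) powr ((q + 1) / q))"
    and "D \<le> (LINT t:{a + lam..b}|lebesgue. g t) * Lp_norm 1 {a..b} (deriv f)"
proof -
  define c where "c = a + lam"
  have abc: "a \<le> c" "c \<le> b" "c - a = (LINT t:{a..b}|lebesgue. g t)" using lam by (auto simp: c_def)
  define B where "B = (LINT t:{c..b}|lebesgue. g t)"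
  define w where "w = (\<lambda>x. min B (if x \<le> c then x - a else b - x))"
  define u where "u = (\<lambda>x. indicat_real {a..b} x * \<bar>deriv f x\<bar>)"
  define v1 where "v1 = (\<lambda>x. indicat_real {a..c} x * (x - a))"
  define v2 where "v2 = (\<lambda>x. indicat_real {c..b} x * (b - x))"
  have k: "set_integrable lebesgue {a..b} (\<lambda>x. \<bar>deriv f x\<bar>)" using h by (rule set_integrable_abs)
  then have iu: "integrable lebesgue u" by (simp add: u_def set_integrable_def)
  have u0: "0 \<le> u x" for x by (simp add: u_def)
  have v0: "0 \<le> v1 x" "0 \<le> v2 x" for x by (auto simp: v1_def v2_def indicator_def)
  have "set_integrable lebesgue {a..b} (\<lambda>x. \<bar>deriv f x\<bar> * w x)"
    and "D \<le> (LINT x:{a..b}|lebesgue. \<bar>deriv f x\<bar> * w x)"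
    using Steffensen_difference_bound[OF abc(1,2) f g g01 abc(3) k] absolutely_continuous_on_interval_increment_le[OF ac h]
    unfolding D_def w_def B_def c_def by auto
  then have iuw: "integrable lebesgue (\<lambda>x. u x * w x)" and D: "D \<le> (\<integral>x. u x * w x \<partial>lebesgue)"
    by (simp_all add: u_def set_integrable_def set_lebesgue_integral_def mult.assoc)
  have vp1: "integrable lebesgue (\<lambda>x. v1 x powr q)" "(\<integral>x. v1 x powr q \<partial>lebesgue) = lam powr (q + 1) / (q + 1)"
   and vp2: "integrable lebesgue (\<lambda>x. v2 x powr q)" "(\<integral>x. v2 x powr q \<partial>lebesgue) = (b - a - lam) powr (q + 1) / (q + 1)"
    if "q > 0" for q
    using integral_ramp_powr[OF abc(1) that] integral_ramp_powr[OF abc(2) that] unfolding v1_def v2_def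
    by (auto simp: c_def algebra_simps)
  \<comment> \<open>The exponent 1 in the ramp formula gives the integrals of the nonnegative ramps
    themselves.\<close>
  have iv: "integrable lebesgue v1" "integrable lebesgue v2"
    "(\<integral>x. v1 x \<partial>lebesgue) = lam\<^sup>2 / 2" "(\<integral>x. v2 x \<partial>lebesgue) = (b - a - lam)\<^sup>2 / 2"
    using vp1[of 1] vp2[of 1] v0 lam by (simp_all add: powr_numeral)
  have uw: "u x * w x \<le> u x * v1 x + u x * v2 x" for x
  proof (cases "x \<in> {a..b}")
    case True
    then have "w x \<le> v1 x + v2 x" by (auto simp: w_def v1_def v2_def indicator_def)
    then have "u x * w x \<le> u x * (v1 x + v2 x)" using u0 by (rule mult_left_mono)
    then show ?thesis by (simp add: algebra_simps)
  qed (simp add: u_def)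
  show "D \<le> (LINT t:{a + lam..b}|lebesgue. g t) * Lp_norm 1 {a..b} (deriv f)"
  proof -
    have "(\<integral>x. u x * w x \<partial>lebesgue) \<le> (\<integral>x. u x * B \<partial>lebesgue)"
      using iuw iu u0 by (intro integral_mono) (auto simp: w_def intro!: mult_left_mono)
    also have "\<dots> = B * (\<integral>x. u x \<partial>lebesgue)" by simp
    also have "(\<integral>x. u x \<partial>lebesgue) = Lp_norm 1 {a..b} (deriv f)"
      using u0 Bochner_Integration.integral_nonneg[of lebesgue u]
      by (simp add: Lp_norm_def u_def set_lebesgue_integral_def)
    finally show ?thesis using D by (simp add: B_def c_def)
  qed
  show "D \<le> 1 / 2 * (lam\<^sup>2 + (b - a - lam)\<^sup>2) * Lp_norm \<infinity> {a..b} (deriv f)" if "in_Lp \<infinity> {a..b} (deriv f)"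
  proof -
    define C where "C = Lp_norm \<infinity> {a..b} (deriv f)"
    have AE: "AE x in lebesgue. x \<in> {a..b} \<longrightarrow> \<bar>deriv f x\<bar> \<le> C"
      unfolding C_def using that by (intro in_Lp_infinity_AE) auto
    have "(\<integral>x. u x * w x \<partial>lebesgue) \<le> (\<integral>x. C * (v1 x + v2 x) \<partial>lebesgue)"
    proof (rule integral_mono_AE[OF iuw])
      show "integrable lebesgue (\<lambda>x. C * (v1 x + v2 x))" using iv by simp
      show "AE x in lebesgue. u x * w x \<le> C * (v1 x + v2 x)"
        using AE
      proof eventually_elim
        case (elim x)
        show ?case
        proof (cases "x \<in> {a..b}")
          case True
          then have "u x * (v1 x + v2 x) \<le> C * (v1 x + v2 x)"
            using elim v0[of x] by (intro mult_right_mono) (auto simp: u_def)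
          then show ?thesis using uw[of x] by (simp add: algebra_simps)
        next
          case False
          then show ?thesis using abc by (auto simp: u_def v1_def v2_def indicator_def)
        qed
      qed
    qed
    also have "\<dots> = 1 / 2 * (lam\<^sup>2 + (b - a - lam)\<^sup>2) * C" using iv by (simp add: field_simps)
    finally show ?thesis using D by (simp add: C_def)
  qed
  show "D \<le> Lp_norm (ereal r) {a..b} (deriv f) / (q + 1) powr (1 / q) *
            (lam powr ((q + 1) / q) + (b - a - lam) powr ((q + 1) / q))"
    if r: "1 < r" "1 / r + 1 / q = 1" and Lr: "in_Lp (ereal r) {a..b} (deriv f)" for r q
  proof -
    define N where "N = Lp_norm (ereal r) {a..b} (deriv f)"
    have q: "q > 0"
    proof -
      have "1 / r < 1" using r(1) by simp
      then have "0 < 1 / q" using r(2) by linarith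
      then show ?thesis by simp
    qed
    have e: "u x powr r = indicat_real {a..b} x * \<bar>deriv f x\<bar> powr r" for x
      by (auto simp: u_def indicator_def)
    have ur: "integrable lebesgue (\<lambda>x. u x powr r)"
      using Lr by (simp add: e in_Lp_def set_integrable_def)
    have N: "(\<integral>x. u x powr r \<partial>lebesgue) powr (1 / r) = N"
      by (simp add: e N_def Lp_norm_def set_lebesgue_integral_def)
    note um = borel_measurable_integrable[OF iu]
    note H1 = Hoelder_inequality[OF r um u0 ur borel_measurable_integrable[OF iv(1)] v0(1) vp1(1)[OF q]]
    note H2 = Hoelder_inequality[OF r um u0 ur borel_measurable_integrable[OF iv(2)] v0(2) vp2(1)[OF q]]
    have pw: "(z powr (q + 1) / (q + 1)) powr (1 / q) = z powr ((q + 1) / q) / (q + 1) powr (1 / q)" if "z \<ge> 0" for z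
      using that q by (simp add: powr_divide powr_powr)
    have lam0: "0 \<le> b - a - lam" using lam(3) by simp
    have "(\<integral>x. u x * w x \<partial>lebesgue) \<le> (\<integral>x. u x * v1 x + u x * v2 x \<partial>lebesgue)"
      using iuw H1(1) H2(1) uw by (intro integral_mono) auto
    also have "\<dots> = (\<integral>x. u x * v1 x \<partial>lebesgue) + (\<integral>x. u x * v2 x \<partial>lebesgue)"
      using H1(1) H2(1) by simp
    also have "\<dots> \<le> N * (lam powr (q + 1) / (q + 1)) powr (1 / q) + N * ((b - a - lam) powr (q + 1) / (q + 1)) powr (1 / q)"
      using H1(2) H2(2) unfolding N vp1(2)[OF q] vp2(2)[OF q] by (rule add_mono)
    also have "\<dots> = N / (q + 1) powr (1 / q) * (lam powr ((q + 1) / q) + (b - a - lam) powr ((q + 1) / q))"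
      unfolding pw[OF lam(2)] pw[OF lam0] by (simp add: distrib_left)
    finally show ?thesis using D by (simp add: N_def)
  qed
qed

theorem theorem6:
  fixes f g :: "real \<Rightarrow> real" and a b lam :: real and p :: ereal
  assumes "a < b"
    and "set_integrable lebesgue {a..b} f"
    and "set_integrable lebesgue {a..b} g"
    and "\<And>t. t \<in> {a..b} \<Longrightarrow> 0 \<le> g t \<and> g t \<le> 1"
    and "RS_integrable g f a b"
    and "lam = (LINT t:{a..b}|lebesgue. g t)"
    and "absolutely_continuous_on_interval a b f"
    and "1 \<le> p"
    and "in_Lp p {a..b} (deriv f)"
  shows "(
     (in_Lp \<infinity> {a..b} (deriv f) \<longrightarrow>
        \<bar>(LINT t:{a..a + lam}|lebesgue. f t) - (LINT t:{a..b}|lebesgue. f t * g t)\<bar>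
        \<le> 1 / 2 * (lam\<^sup>2 + (b - a - lam)\<^sup>2) * Lp_norm \<infinity> {a..b} (deriv f)) \<and>
     (\<forall>r q :: real. 1 < r \<and> 1 / r + 1 / q = 1 \<and> in_Lp (ereal r) {a..b} (deriv f) \<longrightarrow>
        \<bar>(LINT t:{a..a + lam}|lebesgue. f t) - (LINT t:{a..b}|lebesgue. f t * g t)\<bar>
        \<le> Lp_norm (ereal r) {a..b} (deriv f) / (q + 1) powr (1 / q) *
            (lam powr ((q + 1) / q) + (b - a - lam) powr ((q + 1) / q))) \<and>
     (in_Lp 1 {a..b} (deriv f) \<longrightarrow>
        \<bar>(LINT t:{a..a + lam}|lebesgue. f t) - (LINT t:{a..b}|lebesgue. f t * g t)\<bar>
        \<le> (LINT t:{a + lam..b}|lebesgue. g t) * Lp_norm 1 {a..b} (deriv f))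
    ) \<and> (
     (in_Lp \<infinity> {a..b} (deriv f) \<longrightarrow>
        \<bar>(LINT t:{a..b}|lebesgue. f t * g t) - (LINT t:{b - lam..b}|lebesgue. f t)\<bar>
        \<le> 1 / 2 * (lam\<^sup>2 + (b - a - lam)\<^sup>2) * Lp_norm \<infinity> {a..b} (deriv f)) \<and>
     (\<forall>r q :: real. 1 < r \<and> 1 / r + 1 / q = 1 \<and> in_Lp (ereal r) {a..b} (deriv f) \<longrightarrow>
        \<bar>(LINT t:{a..b}|lebesgue. f t * g t) - (LINT t:{b - lam..b}|lebesgue. f t)\<bar>
        \<le> Lp_norm (ereal r) {a..b} (deriv f) / (q + 1) powr (1 / q) *
            (lam powr ((q + 1) / q) + (b - a - lam) powr ((q + 1) / q))) \<and>
     (in_Lp 1 {a..b} (deriv f) \<longrightarrow>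
        \<bar>(LINT t:{a..b}|lebesgue. f t * g t) - (LINT t:{b - lam..b}|lebesgue. f t)\<bar>
        \<le> (LINT t:{a..b - lam}|lebesgue. g t) * Lp_norm 1 {a..b} (deriv f)))"
proof -
  have h: "set_integrable lebesgue {a..b} (deriv f)"
    by (rule in_Lp_imp_integrable[OF assms(9,8)])
  have one: "set_integrable lebesgue {a..b} (\<lambda>t. 1 :: real)" "(LINT t:{x..y}|lebesgue. 1 :: real) = y - x"
    if "x \<le> y" for x y :: real
    using assms(1) that by (simp_all add: set_integrable_def set_lebesgue_integral_def emeasure_lborel_Icc_eq)
  have lam: "0 \<le> lam" "lam \<le> b - a"
  proof -
    show "0 \<le> lam" unfolding assms(6) set_lebesgue_integral_def
      using assms(4) by (intro Bochner_Integration.integral_nonneg) (auto simp: indicator_def)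
    have "lam \<le> (LINT t:{a..b}|lebesgue. 1)" unfolding assms(6)
      using assms(1,3,4) one(1) by (intro set_integral_mono) auto
    then show "lam \<le> b - a" using one(2)[of a b] assms(1) by simp
  qed
  \<comment> \<open>Passing to \<open>1 - g\<close> replaces \<open>lam\<close> by
    \<open>b - a - lam\<close>. The interval \<open>{a..a + lam'}\<close> is then
    \<open>{a..b - lam}\<close>, and the two lengths in the bounds trade places.\<close>
  define g' where "g' = (\<lambda>t. 1 - g t)"
  define lam' where "lam' = b - a - lam"
  have g': "set_integrable lebesgue {a..b} g'" "lam' = (LINT t:{a..b}|lebesgue. g' t)"
    unfolding g'_def lam'_def using one assms(1,3,6)
    by (auto intro!: set_integral_diff(1) simp: set_integral_diff(2))
  have g'01: "0 \<le> g' t \<and> g' t \<le> 1" if "t \<in> {a..b}" for t using assms(4)[OF that] by (auto simp: g'_def)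
  have lam': "0 \<le> lam'" "lam' \<le> b - a" "a + lam' = b - lam" "b - a - lam' = lam"
    using lam by (auto simp: lam'_def)
  have split: "(LINT t:{a..b}|lebesgue. k t) = (LINT t:{a..b - lam}|lebesgue. k t) + (LINT t:{b - lam..b}|lebesgue. k t)"
    if k: "set_integrable lebesgue {a..b} k" for k :: "real \<Rightarrow> real"
  proof -
    have "integrable lebesgue (\<lambda>t. indicat_real {a..b - lam} t * k t)" "integrable lebesgue (\<lambda>t. indicat_real {b - lam..b} t * k t)"
      using set_integrable_subset[OF k, of "{a..b - lam}"] set_integrable_subset[OF k, of "{b - lam..b}"] lam
      by (auto simp: set_integrable_def)
    moreover have "integral {a..b - lam} k + integral {b - lam..b} k = integral {a..b} k"
      using lam set_lebesgue_integral_eq_integral(1)[OF k]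
      by (intro Henstock_Kurzweil_Integration.integral_combine) auto
    ultimately show ?thesis
      using k by (simp add: set_lebesgue_integral_eq_integral(2) set_integrable_def)
  qed
  have fg: "set_integrable lebesgue {a..b} (\<lambda>t. f t * g t)"
  proof -
    have "integrable lebesgue (\<lambda>t. (indicat_real {a..b} t * f t) * (indicat_real {a..b} t * g t))"
    proof (rule integrable_times_bounded[of _ _ _ 1])
      show "\<bar>indicat_real {a..b} x * g x\<bar> \<le> 1" for x using assms(4)[of x] by (auto simp: indicator_def)
    qed (use assms(2,3) in \<open>auto simp: set_integrable_def dest: borel_measurable_integrable\<close>)
    also have "(\<lambda>t. (indicat_real {a..b} t * f t) * (indicat_real {a..b} t * g t)) = (\<lambda>t. indicat_real {a..b} t * (f t * g t))"
      by (auto simp: indicator_def)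
    finally show ?thesis by (simp add: set_integrable_def)
  qed
  \<comment> \<open>The integral of \<open>f\<close> over \<open>{a..b - lam}\<close> minus that
    over \<open>{a..b}\<close> leaves minus the integral over \<open>{b - lam..b}\<close>.\<close>
  have refl_g: "(LINT t:{a..a + lam'}|lebesgue. f t) - (LINT t:{a..b}|lebesgue. f t * g' t)
      = (LINT t:{a..b}|lebesgue. f t * g t) - (LINT t:{b - lam..b}|lebesgue. f t)"
  proof -
    have "(\<lambda>t. f t * g' t) = (\<lambda>t. f t - f t * g t)" by (auto simp: g'_def algebra_simps)
    then have "(LINT t:{a..b}|lebesgue. f t * g' t) = (LINT t:{a..b}|lebesgue. f t) - (LINT t:{a..b}|lebesgue. f t * g t)"
      using assms(2) fg by (simp add: set_integral_diff(2))
    then show ?thesis using split[OF assms(2)] unfolding lam'(3) by linarith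
  qed
  \<comment> \<open>The left side is \<open>lam\<close> minus the integral of \<open>g\<close> over
    \<open>{b - lam..b}\<close>, and \<open>lam\<close> is the integral of \<open>g\<close> over all
    of \<open>{a..b}\<close>.\<close>
  have refl_L1: "(LINT t:{a + lam'..b}|lebesgue. g' t) = (LINT t:{a..b - lam}|lebesgue. g t)"
  proof -
    have "set_integrable lebesgue {b - lam..b} (\<lambda>t. 1 :: real)" "set_integrable lebesgue {b - lam..b} g"
      using lam one(1)[of a b] assms(1) by (auto intro: set_integrable_subset[OF assms(3)] set_integrable_subset[OF one(1)])
    then have "(LINT t:{b - lam..b}|lebesgue. g' t) = (LINT t:{b - lam..b}|lebesgue. 1) - (LINT t:{b - lam..b}|lebesgue. g t)"
      unfolding g'_def by (rule set_integral_diff(2))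
    also have "(LINT t:{b - lam..b}|lebesgue. 1 :: real) = lam"
      using one(2)[of "b - lam" b] lam(1) by simp
    finally have "(LINT t:{b - lam..b}|lebesgue. g' t) = lam - (LINT t:{b - lam..b}|lebesgue. g t)" .
    then show ?thesis using split[OF assms(3)] assms(6) unfolding lam'(3) by linarith
  qed
  note S = Steffensen_deviation_bounds[OF assms(2,3,4,6) lam assms(7) h]
  note S' = Steffensen_deviation_bounds[OF assms(2) g'(1) g'01 g'(2) lam'(1,2) assms(7) h,
      unfolded refl_g refl_L1 lam'(4), unfolded lam'_def]
  \<comment> \<open>In the bounds for \<open>g'\<close> the terms in \<open>lam\<close> and
    \<open>b - a - lam\<close> come in the opposite order.\<close>
  show ?thesis using S S' by (auto simp: add.commute)
qed

end
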